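(* Let $n\geq 12$. Define the following trees on $n$ vertices: - $T^1_n$: a vertex $c$ adjacent to $n-3$ leaves and to one further vertex $u$, where $u$ is adjacent to exactly one other vertex, which is a leaf (i.e., the star $S_{n-1}$ with a pendant vertex attached to one of its leaves; $c$ has degree $n-2$); - $T^2_n$: a vertex $c$ adjacent to $n-4$ leaves and to the first vertex of a path $u\,w\,z$ (edges $cu,uw,wz$, with $z$ a leaf); $c$ has degree $n-3$; - $T^3_n$: a vertex $c$ adjacent to $n-4$ leaves and to one further vertex $u$, where $u$ is adjacent to exactly two other vertices, both leaves; $c$ has degree $n-3$; - $T^4_n$: a vertex $c$ adjacent to $n-5$ leaves and to two further vertices $u_1,u_2$, where each $u_i$ is adjacent to exactly one other vertex, which is a leaf; $c$ has degree $n-3$. Let $S_n$ be the star on $n$ vertices. Then for every tree $T$ on $n$ vertices not isomorphic to any of $S_n,T^1_n,T^2_n,T^3_n,T^4_n$, $$\eta_1(T)<\eta_1(T^4_n)<\eta_1(T^3_n)<\eta_1(T^2_n)<\eta_1(T^1_n)<\eta_1(S_n).$$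
   Context: For a simple graph $G$ with vertex set $\{v_1,\dots,v_n\}$ and no isolated vertices, let $d_i$ denote the degree of $v_i$. The extended adjacency matrix $A_{ex}(G)=(a^{ex}_{ij})$ is the $n\times n$ matrix with $a^{ex}_{ij}=\frac12\left(\frac{d_i}{d_j}+\frac{d_j}{d_i}\right)$ if $v_iv_j$ is an edge of $G$ and $a^{ex}_{ij}=0$ otherwise. The extended spectral radius $\eta_1(G)$ is the largest eigenvalue of $A_{ex}(G)$. *)

theory Defs
  imports "Graph_Theory.Graph_Theory" "Jordan_Normal_Form.Char_Poly"
begin

text \<open>
  Finite simple graphs are modelled as in \<open>Graph_Theory\<close>: \<open>pair_graph G\<close> says that \<open>G\<close> is a
  finite, symmetric, loop-free pair digraph, so an edge \<open>uv\<close> is the pair of arcs \<open>(u,v)\<close>, \<open>(v,u)\<close>.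
  The library constant \<open>tree\<close> is of no use for such graphs, because the walk \<open>u, v, u\<close> counts as
  a cycle there; a cycle of a simple graph has length at least 3.
\<close>

definition simple_tree :: "'a pair_pre_digraph \<Rightarrow> bool" where
  "simple_tree T \<longleftrightarrow>
     pair_graph T \<and> connected (with_proj T) \<and>
     \<not> (\<exists>p. pre_digraph.cycle (with_proj T) p \<and> 3 \<le> length p)"

abbreviation deg :: "'a pair_pre_digraph \<Rightarrow> 'a \<Rightarrow> real" where
  "deg G v \<equiv> real (out_degree (with_proj G) v)"

definition ext_adj :: "'a pair_pre_digraph \<Rightarrow> 'a \<Rightarrow> 'a \<Rightarrow> real" where
  "ext_adj G u v =
     (if (u, v) \<in> parcs G then (deg G u / deg G v + deg G v / deg G u) / 2 else 0)"

text \<open>The list \<open>vs\<close> is the enumeration \<open>v\<^sub>1, \<dots>, v\<^sub>n\<close> of the vertices.\<close>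

definition ext_adj_mat :: "'a pair_pre_digraph \<Rightarrow> 'a list \<Rightarrow> real mat" where
  "ext_adj_mat G vs = mat (length vs) (length vs) (\<lambda>(i, j). ext_adj G (vs ! i) (vs ! j))"

text \<open>
  By \<open>ext_spectral_radius_enum\<close> below, the value does not depend on the enumeration chosen.
\<close>

definition ext_spectral_radius :: "'a pair_pre_digraph \<Rightarrow> real" ("\<eta>\<^sub>1") where
  "\<eta>\<^sub>1 G = Max {k. eigenvalue (ext_adj_mat G (SOME vs. distinct vs \<and> set vs = pverts G)) k}"

definition graph_of_edges :: "'a set \<Rightarrow> ('a \<times> 'a) set \<Rightarrow> 'a pair_pre_digraph" where
  "graph_of_edges V E = \<lparr>pverts = V, parcs = E \<union> E\<inverse>\<rparr>"

text \<open>In all of the following trees on \<open>{0..<n}\<close> the vertex \<open>c\<close> is \<open>0\<close>.\<close>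

definition star :: "nat \<Rightarrow> nat pair_pre_digraph" where
  "star n = graph_of_edges {0..<n} ({0} \<times> {1..<n})"

text \<open>\<open>u = n - 2\<close>\<close>
definition T1 :: "nat \<Rightarrow> nat pair_pre_digraph" where
  "T1 n = graph_of_edges {0..<n} ({0} \<times> {1..n - 2} \<union> {(n - 2, n - 1)})"

text \<open>\<open>u = n - 3\<close>, \<open>w = n - 2\<close>, \<open>z = n - 1\<close>\<close>
definition T2 :: "nat \<Rightarrow> nat pair_pre_digraph" where
  "T2 n = graph_of_edges {0..<n} ({0} \<times> {1..n - 3} \<union> {(n - 3, n - 2), (n - 2, n - 1)})"

text \<open>\<open>u = n - 3\<close>\<close>
definition T3 :: "nat \<Rightarrow> nat pair_pre_digraph" where
  "T3 n = graph_of_edges {0..<n} ({0} \<times> {1..n - 3} \<union> {(n - 3, n - 2), (n - 3, n - 1)})"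

text \<open>\<open>u\<^sub>1 = n - 4\<close>, \<open>u\<^sub>2 = n - 3\<close>\<close>
definition T4 :: "nat \<Rightarrow> nat pair_pre_digraph" where
  "T4 n = graph_of_edges {0..<n} ({0} \<times> {1..n - 3} \<union> {(n - 4, n - 2), (n - 3, n - 1)})"

lemma eigenvalue_ext_adj_mat_iff:
  assumes vs: "distinct vs" "set vs = pverts G"
  shows "eigenvalue (ext_adj_mat G vs) k \<longleftrightarrow>
    (\<exists>x. (\<exists>u\<in>pverts G. x u \<noteq> 0) \<and>
         (\<forall>u\<in>pverts G. (\<Sum>w\<in>pverts G. ext_adj G u w * x w) = k * x u))"
    (is "?L \<longleftrightarrow> ?R")
proof -
  let ?n = "length vs"
  have bij: "bij_betw ((!) vs) {0..<?n} (pverts G)"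
    using bij_betw_nth[of vs "{0..<?n}" "pverts G"] vs by (simp add: atLeast0LessThan)
  have row: "row (ext_adj_mat G vs) i \<bullet> v = (\<Sum>j = 0..<?n. ext_adj G (vs ! i) (vs ! j) * v $ j)"
    if "i < ?n" "dim_vec v = ?n" for i v
    using that by (simp add: scalar_prod_def ext_adj_mat_def)
  have sum: "(\<Sum>w\<in>pverts G. f w) = (\<Sum>j = 0..<?n. f (vs ! j))" for f :: "'a \<Rightarrow> real"
    using sum.reindex_bij_betw[OF bij, of f] by simp
  have dim: "dim_row (ext_adj_mat G vs) = ?n" "dim_col (ext_adj_mat G vs) = ?n"
    by (simp_all add: ext_adj_mat_def)
  show ?thesis
  proof
    assume ?L
    then obtain v where v: "dim_vec v = ?n" "v \<noteq> 0\<^sub>v ?n"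
      "ext_adj_mat G vs *\<^sub>v v = k \<cdot>\<^sub>v v"
      unfolding eigenvalue_def eigenvector_def dim using carrier_vecD by blast
    define x where "x = (\<lambda>u. v $ the_inv_into {0..<?n} ((!) vs) u)"
    have x: "x (vs ! i) = v $ i" if "i < ?n" for i
      using that bij by (simp add: x_def the_inv_into_f_f bij_betw_def)
    from v(1,2) obtain i where i: "i < ?n" "v $ i \<noteq> 0"
      by (metis eq_vecI index_zero_vec)
    have "(\<Sum>w\<in>pverts G. ext_adj G u w * x w) = k * x u" if "u \<in> pverts G" for u
    proof -
      from that vs obtain i where i: "i < ?n" "u = vs ! i" by (metis in_set_conv_nth)
      have "(ext_adj_mat G vs *\<^sub>v v) $ i = k * v $ i" using v i by simp
      moreover have "(ext_adj_mat G vs *\<^sub>v v) $ i = row (ext_adj_mat G vs) i \<bullet> v"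
        using i by (simp add: dim)
      ultimately show ?thesis using i v row[of i v] by (simp add: sum x)
    qed
    moreover have "vs ! i \<in> pverts G" "x (vs ! i) \<noteq> 0" using i x vs by auto
    ultimately show ?R by blast
  next
    assume ?R
    then obtain x u where x: "u \<in> pverts G" "x u \<noteq> 0"
      "\<And>u. u \<in> pverts G \<Longrightarrow> (\<Sum>w\<in>pverts G. ext_adj G u w * x w) = k * x u" by blast
    define v where "v = vec ?n (\<lambda>i. x (vs ! i))"
    from x vs obtain i where i: "i < ?n" "u = vs ! i" by (metis in_set_conv_nth)
    have "v \<noteq> 0\<^sub>v ?n"
    proof
      assume "v = 0\<^sub>v ?n"
      then have "v $ i = 0" using i by simp
      then show False using i x by (simp add: v_def)
    qed
    moreover have "ext_adj_mat G vs *\<^sub>v v = k \<cdot>\<^sub>v v"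
    proof (rule eq_vecI)
      fix i assume "i < dim_vec (k \<cdot>\<^sub>v v)"
      then have i: "i < ?n" by (simp add: v_def)
      then have "(ext_adj_mat G vs *\<^sub>v v) $ i = row (ext_adj_mat G vs) i \<bullet> v"
        by (simp add: dim)
      also have "\<dots> = (\<Sum>j = 0..<?n. ext_adj G (vs ! i) (vs ! j) * v $ j)"
        using row[of i v] i by (simp add: v_def)
      also have "\<dots> = (\<Sum>w\<in>pverts G. ext_adj G (vs ! i) w * x w)"
        by (simp add: sum v_def)
      also have "\<dots> = k * x (vs ! i)" 
        using x(3)[of "vs ! i"] nth_mem[OF i] vs(2) by simp
      finally show "(ext_adj_mat G vs *\<^sub>v v) $ i = (k \<cdot>\<^sub>v v) $ i" using i by (simp add: v_def)
    qed (simp add: dim v_def)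
    moreover have "v \<in> carrier_vec ?n" by (simp add: v_def)
    ultimately show ?L unfolding eigenvalue_def eigenvector_def by (auto simp: dim)
  qed
qed

lemma ext_spectral_radius_enum:
  assumes "distinct vs" "set vs = pverts G"
  shows "\<eta>\<^sub>1 G = Max {k. eigenvalue (ext_adj_mat G vs) k}"
proof -
  define ws where "ws = (SOME vs. distinct vs \<and> set vs = pverts G)"
  have "distinct ws \<and> set ws = pverts G"
    unfolding ws_def by (rule someI[of _ vs]) (use assms in simp)
  then have "eigenvalue (ext_adj_mat G ws) = eigenvalue (ext_adj_mat G vs)"
    using eigenvalue_ext_adj_mat_iff[of ws G] eigenvalue_ext_adj_mat_iff[OF assms] by blast
  then show ?thesis
    unfolding ext_spectral_radius_def ws_def[symmetric] by simp
qed

lemma pair_graph_graph_of_edges: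
  assumes "finite V" "E \<subseteq> V \<times> V" "\<And>v. (v, v) \<notin> E"
  shows "pair_graph (graph_of_edges V E)"
proof -
  have "finite E" using assms(1,2) finite_subset by blast
  then show ?thesis
    using assms
    by unfold_locales
      (auto simp: graph_of_edges_def symmetric_def arcs_ends_def arc_to_ends_def with_proj_def
        sym_def)
qed

lemma digraph_iso_pair_iff:
  assumes G: "pair_wf_digraph G" and H: "pair_wf_digraph H"
  shows "digraph_iso (with_proj G) (with_proj H) \<longleftrightarrow>
    (\<exists>f. bij_betw f (pverts G) (pverts H) \<and>
         (\<forall>u\<in>pverts G. \<forall>v\<in>pverts G. (u, v) \<in> parcs G \<longleftrightarrow> (f u, f v) \<in> parcs H))"
    (is "?L \<longleftrightarrow> ?R")
proof
  assume ?L
  then obtain h where h: "pre_digraph.digraph_isomorphism (with_proj G) h"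
    "with_proj H = app_iso h (with_proj G)" unfolding digraph_iso_def by blast
  let ?f = "iso_verts h"
  have eqs: "pverts H = ?f ` pverts G" "parcs H = iso_arcs h ` parcs G"
      "iso_tail h = fst" "iso_head h = snd"
    using h(2) by (auto simp: with_proj_def app_iso_def)
  have inj: "inj_on ?f (pverts G)"
    and arc: "\<And>a. a \<in> parcs G \<Longrightarrow> iso_arcs h a = (?f (fst a), ?f (snd a))"
    using h(1) eqs(3,4) unfolding pre_digraph.digraph_isomorphism_def
    by (auto simp: with_proj_def prod_eq_iff)
  have "(u, v) \<in> parcs G \<longleftrightarrow> (?f u, ?f v) \<in> parcs H"
    if uv: "u \<in> pverts G" "v \<in> pverts G" for u v
  proof
    assume "(u, v) \<in> parcs G"
    then show "(?f u, ?f v) \<in> parcs H" using arc eqs(2) by force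
  next
    assume "(?f u, ?f v) \<in> parcs H"
    then obtain a where a: "a \<in> parcs G" "(?f u, ?f v) = (?f (fst a), ?f (snd a))"
      using arc eqs(2) by auto
    moreover have "fst a \<in> pverts G" "snd a \<in> pverts G"
      using pair_wf_digraph.arc_fst_in_verts[OF G a(1)] pair_wf_digraph.arc_snd_in_verts[OF G a(1)]
      by simp_all
    ultimately have "a = (u, v)" using inj uv by (auto simp: inj_on_def prod_eq_iff)
    then show "(u, v) \<in> parcs G" using a by simp
  qed
  then show ?R using inj eqs(1) by (auto simp: bij_betw_def)
next
  assume ?R
  then obtain f where f: "inj_on f (pverts G)" "f ` pverts G = pverts H"
    and e: "\<And>u v. u \<in> pverts G \<Longrightarrow> v \<in> pverts G \<Longrightarrow>
      (u, v) \<in> parcs G \<longleftrightarrow> (f u, f v) \<in> parcs H"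
    by (auto simp: bij_betw_def)
  have Gv: "u \<in> pverts G" "v \<in> pverts G" if "(u, v) \<in> parcs G" for u v
    using G that by (force simp: pair_wf_digraph_def)+
  have Hv: "u \<in> pverts H" "v \<in> pverts H" if "(u, v) \<in> parcs H" for u v
    using H that by (force simp: pair_wf_digraph_def)+
  let ?h = "\<lparr>iso_verts = f, iso_arcs = map_prod f f, iso_head = snd, iso_tail = fst\<rparr>"
  have wf: "wf_digraph (with_proj G)"
    using Gv by unfold_locales (auto simp: with_proj_def)
  have inj: "inj_on (map_prod f f) (parcs G)"
    by (rule inj_on_subset[OF map_prod_inj_on[OF f(1) f(1)]]) (use Gv in auto)
  have "map_prod f f ` parcs G = parcs H"
  proof
    show "map_prod f f ` parcs G \<subseteq> parcs H"
    proof
      fix a assume "a \<in> map_prod f f ` parcs G"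
      then obtain u v where uv: "(u, v) \<in> parcs G" "a = (f u, f v)" by auto
      then show "a \<in> parcs H" using e[OF Gv[OF uv(1)]] by blast
    qed
    show "parcs H \<subseteq> map_prod f f ` parcs G"
    proof
      fix a assume a: "a \<in> parcs H"
      then have "fst a \<in> f ` pverts G" "snd a \<in> f ` pverts G"
        using Hv[of "fst a" "snd a"] f(2) by auto
      then obtain u v where uv: "u \<in> pverts G" "v \<in> pverts G" "fst a = f u" "snd a = f v"
        by auto
      then have "a = map_prod f f (u, v)" by (simp add: prod_eq_iff)
      moreover from this have "(u, v) \<in> parcs G" using e[OF uv(1,2)] a by simp
      ultimately show "a \<in> map_prod f f ` parcs G" by blast
    qed
  qed
  then have "with_proj H = app_iso ?h (with_proj G)"
    using f by (simp add: with_proj_def app_iso_def)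
  moreover have "pre_digraph.digraph_isomorphism (with_proj G) ?h"
    using wf f inj unfolding pre_digraph.digraph_isomorphism_def by (simp add: with_proj_def)
  ultimately show ?L unfolding digraph_iso_def by blast
qed

lemma
  assumes "4 < n"
  shows pair_graph_star: "pair_graph (star n)" and pair_graph_T1: "pair_graph (T1 n)"
    and pair_graph_T2: "pair_graph (T2 n)" and pair_graph_T3: "pair_graph (T3 n)"
    and pair_graph_T4: "pair_graph (T4 n)"
  unfolding star_def T1_def T2_def T3_def T4_def
  by (rule pair_graph_graph_of_edges; use assms in auto)+

end

theory Submission
  imports
    "HOL-Analysis.Function_Topology" "HOL-Analysis.Convex" "Jordan_Normal_Form.Spectral_Radius" Defs
begin

text \<open>
  All comparisons are made between bounds for \<open>4 \<eta>\<^sub>1\<^sup>2\<close>. From below, the square of the top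
  eigenvalue of a symmetric nonnegative matrix dominates the sum of the squares of every row; for
  the row of a vertex \<open>c\<close> this is the sum of \<open>(d\<^sub>c/d\<^sub>w + d\<^sub>w/d\<^sub>c)\<^sup>2\<close> over the neighbours \<open>w\<close> of \<open>c\<close>.
  From above, a tree is bipartite, so \<open>2 \<eta>\<^sub>1\<^sup>2\<close> is at most the squared Frobenius norm of the matrix;
  this is at most half the sum of \<open>d\<^sup>3 + d\<close> over all vertices, and convexity makes that sum largest,
  for maximal degree \<open>\<Delta> \<ge> n/2\<close>, when there is one vertex of degree \<open>\<Delta>\<close>, one of degree \<open>n - \<Delta>\<close> and
  otherwise leaves. This settles every comparison between trees of different maximal degree, and
  the trees of maximal degree at least \<open>n - 3\<close> are the five exceptions. The trees \<open>T\<^sup>2\<close>, \<open>T\<^sup>3\<close>, \<open>T\<^sup>4\<close>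
  share the maximal degree \<open>n - 3\<close>; there \<open>T\<^sup>3\<close> and \<open>T\<^sup>4\<close> are bounded from above by a positive
  vector \<open>y\<close> with \<open>A y \<le> k y\<close>, which loses less than the Frobenius norm.
\<close>

section \<open>Eigenvalues of real matrices\<close>

definition bilinear_form ::
    "'a set \<Rightarrow> ('a \<Rightarrow> 'a \<Rightarrow> real) \<Rightarrow> ('a \<Rightarrow> real) \<Rightarrow> ('a \<Rightarrow> real) \<Rightarrow> real" where
  "bilinear_form V b x y = (\<Sum>u\<in>V. x u * (\<Sum>w\<in>V. b u w * y w))"

definition eigenvalue_on :: "'a set \<Rightarrow> ('a \<Rightarrow> 'a \<Rightarrow> real) \<Rightarrow> real \<Rightarrow> bool" where
  "eigenvalue_on V b k \<longleftrightarrow>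
     (\<exists>x. (\<exists>u\<in>V. x u \<noteq> 0) \<and> (\<forall>u\<in>V. (\<Sum>w\<in>V. b u w * x w) = k * x u))"

definition rayleigh_bound :: "'a set \<Rightarrow> ('a \<Rightarrow> 'a \<Rightarrow> real) \<Rightarrow> real \<Rightarrow> bool" where
  "rayleigh_bound V b k \<longleftrightarrow> (\<forall>x. bilinear_form V b x x \<le> k * (\<Sum>u\<in>V. (x u)\<^sup>2))"

definition symmetric_on :: "'a set \<Rightarrow> ('a \<Rightarrow> 'a \<Rightarrow> real) \<Rightarrow> bool" where
  "symmetric_on V b \<longleftrightarrow> (\<forall>u\<in>V. \<forall>w\<in>V. b u w = b w u)"

definition nonneg_on :: "'a set \<Rightarrow> ('a \<Rightarrow> 'a \<Rightarrow> real) \<Rightarrow> bool" where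
  "nonneg_on V b \<longleftrightarrow> (\<forall>u\<in>V. \<forall>w\<in>V. 0 \<le> b u w)"

lemma eigenvalue_onE:
  assumes "eigenvalue_on V b k"
  obtains x where "\<exists>u\<in>V. x u \<noteq> 0" and "\<And>u. u \<in> V \<Longrightarrow> (\<Sum>w\<in>V. b u w * x w) = k * x u"
  using assms unfolding eigenvalue_on_def by blast

lemma bilinear_form_commute:
  assumes "symmetric_on V b"
  shows "bilinear_form V b x y = bilinear_form V b y x"
proof -
  have "bilinear_form V b x y = (\<Sum>w\<in>V. \<Sum>u\<in>V. x u * (b u w * y w))"
    unfolding bilinear_form_def sum_distrib_left by (rule sum.swap)
  also have "\<dots> = bilinear_form V b y x"
    unfolding bilinear_form_def sum_distrib_left
    by (intro sum.cong refl) (use assms in \<open>simp add: symmetric_on_def mult_ac\<close>)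
  finally show ?thesis .
qed

lemma bilinear_form_add_scaled:
  assumes "symmetric_on V b"
  shows "bilinear_form V b (\<lambda>u. x u + t * y u) (\<lambda>u. x u + t * y u)
    = bilinear_form V b x x + 2 * t * bilinear_form V b y x + t\<^sup>2 * bilinear_form V b y y"
proof -
  have "bilinear_form V b (\<lambda>u. x u + t * y u) (\<lambda>u. x u + t * y u)
      = bilinear_form V b x x + t * bilinear_form V b x y + t * bilinear_form V b y x
        + t\<^sup>2 * bilinear_form V b y y"
    by (simp add: bilinear_form_def distrib_left distrib_right sum.distrib sum_distrib_left
        power2_eq_square mult_ac)
  then show ?thesis using bilinear_form_commute[OF assms, of x y] by simp
qed

lemma sum_squares_add_scaled:
  fixes x y :: "'a \<Rightarrow> real"
  shows "(\<Sum>u\<in>V. (x u + t * y u)\<^sup>2)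
    = (\<Sum>u\<in>V. (x u)\<^sup>2) + 2 * t * (\<Sum>u\<in>V. y u * x u) + t\<^sup>2 * (\<Sum>u\<in>V. (y u)\<^sup>2)"
  by (simp add: power2_sum power_mult_distrib sum.distrib sum_distrib_left mult_ac)

lemma sum_of_bool_eq_mult:
  fixes f :: "'a \<Rightarrow> real"
  assumes "finite V" "a \<in> V"
  shows "(\<Sum>u\<in>V. of_bool (u = a) * f u) = f a"
proof -
  have "V \<inter> {u. u = a} = {a}" using assms(2) by auto
  then show ?thesis using assms(1) by (simp add: sum_of_bool_mult_eq)
qed

lemma rayleigh_bound_diagonal:
  assumes "finite V" "a \<in> V" "rayleigh_bound V b k"
  shows "b a a \<le> k"
proof -
  let ?e = "\<lambda>u. of_bool (u = a) :: real"
  have "bilinear_form V b ?e ?e \<le> k * (\<Sum>u\<in>V. (?e u)\<^sup>2)"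
    using assms(3) unfolding rayleigh_bound_def by blast
  then show ?thesis
    using sum_of_bool_eq_mult[OF assms(1,2)]
    by (simp add: bilinear_form_def mult.commute[of "b _ _"] power2_eq_square)
qed

lemma eigenvalue_on_le_rayleigh_bound:
  assumes "finite V" "eigenvalue_on V b k" "rayleigh_bound V b m"
  shows "k \<le> m"
proof -
  obtain x where nonzero: "\<exists>u\<in>V. x u \<noteq> 0"
    and eigen: "\<And>u. u \<in> V \<Longrightarrow> (\<Sum>w\<in>V. b u w * x w) = k * x u"
    using eigenvalue_onE[OF assms(2)] by blast
  have "k * (\<Sum>u\<in>V. (x u)\<^sup>2) = bilinear_form V b x x"
    unfolding bilinear_form_def sum_distrib_left[of k]
    by (rule sum.cong) (simp_all add: eigen power2_eq_square)
  also have "\<dots> \<le> m * (\<Sum>u\<in>V. (x u)\<^sup>2)" using assms(3) by (simp add: rayleigh_bound_def)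
  finally have "k * (\<Sum>u\<in>V. (x u)\<^sup>2) \<le> m * (\<Sum>u\<in>V. (x u)\<^sup>2)" .
  moreover have "0 < (\<Sum>u\<in>V. (x u)\<^sup>2)" using nonzero assms(1) by (auto intro: sum_pos2)
  ultimately show ?thesis by simp
qed

definition unit_sphere_on :: "'a set \<Rightarrow> ('a \<Rightarrow> real) set" where
  "unit_sphere_on V = {x. (\<forall>u. u \<notin> V \<longrightarrow> x u = 0) \<and> (\<Sum>u\<in>V. (x u)\<^sup>2) = 1}"

lemma compact_unit_sphere_on:
  assumes "finite V"
  shows "compact (unit_sphere_on V)"
proof -
  define I where "I u = (if u \<in> V then {-1..1} else {0::real})" for u
  have "compactin (product_topology (\<lambda>_. euclidean) UNIV) (PiE UNIV I)"
    by (simp add: compactin_PiE I_def)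
  then have "compact (PiE UNIV I)" by (simp add: euclidean_product_topology)
  moreover have "closed {x :: 'a \<Rightarrow> real. (\<Sum>u\<in>V. (x u)\<^sup>2) = 1}"
    by (intro closed_Collect_eq continuous_intros continuous_on_product_coordinates)
  moreover have "unit_sphere_on V = PiE UNIV I \<inter> {x. (\<Sum>u\<in>V. (x u)\<^sup>2) = 1}"
  proof -
    have "\<bar>x u\<bar> \<le> 1" if "(\<Sum>u\<in>V. (x u)\<^sup>2) = 1" "u \<in> V" for x :: "'a \<Rightarrow> real" and u
    proof -
      have "(x u)\<^sup>2 \<le> (\<Sum>u\<in>V. (x u)\<^sup>2)" by (rule member_le_sum) (use that assms in auto)
      then show ?thesis using that by (simp add: abs_square_le_1)
    qed
    then show ?thesis
      by (auto simp: unit_sphere_on_def I_def PiE_iff abs_le_iff minus_le_iff split: if_splits)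
  qed
  ultimately show ?thesis by (simp add: compact_Int_closed)
qed

lemma rayleigh_bound_if_unit_sphere:
  assumes "finite V"
    and unit: "\<And>x. x \<in> unit_sphere_on V \<Longrightarrow> bilinear_form V b x x \<le> k"
  shows "rayleigh_bound V b k"
  unfolding rayleigh_bound_def
proof
  fix x
  define s where "s = sqrt (\<Sum>u\<in>V. (x u)\<^sup>2)"
  have s_squared: "s\<^sup>2 = (\<Sum>u\<in>V. (x u)\<^sup>2)" by (simp add: s_def sum_nonneg)
  show "bilinear_form V b x x \<le> k * (\<Sum>u\<in>V. (x u)\<^sup>2)"
  proof (cases "s = 0")
    case True
    then have "\<forall>u\<in>V. x u = 0" using s_squared assms(1) by (simp add: sum_nonneg_eq_0_iff)
    then show ?thesis by (simp add: bilinear_form_def)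
  next
    case False
    define z where "z u = (if u \<in> V then x u / s else 0)" for u
    have "(\<Sum>u\<in>V. (z u)\<^sup>2) = (\<Sum>u\<in>V. (x u)\<^sup>2) / s\<^sup>2"
      by (simp add: z_def power_divide sum_divide_distrib)
    then have "(\<Sum>u\<in>V. (z u)\<^sup>2) = 1" using False unfolding s_squared[symmetric] by simp
    then have "bilinear_form V b z z \<le> k" by (intro unit) (simp add: unit_sphere_on_def z_def)
    moreover have "bilinear_form V b z z = bilinear_form V b x x / s\<^sup>2"
      by (simp add: bilinear_form_def z_def sum_divide_distrib sum_distrib_left power2_eq_square)
    ultimately show ?thesis using False unfolding s_squared[symmetric] by (simp add: divide_le_eq)
  qed
qed

lemma rayleigh_bound_attained:
  assumes "finite V" "V \<noteq> {}"
  obtains x where "(\<Sum>u\<in>V. (x u)\<^sup>2) = 1" and "rayleigh_bound V b (bilinear_form V b x x)"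
proof -
  let ?S = "unit_sphere_on V"
  obtain a where "a \<in> V" using assms(2) by blast
  then have "(\<lambda>u. of_bool (u = a)) \<in> ?S"
    using sum_of_bool_eq_mult[OF assms(1), of a "\<lambda>u. of_bool (u = a)"]
    by (auto simp: unit_sphere_on_def power2_eq_square)
  then have "?S \<noteq> {}" by blast
  moreover have "compact ?S" using assms(1) by (rule compact_unit_sphere_on)
  moreover have "continuous_on UNIV (\<lambda>x. bilinear_form V b x x)"
    unfolding bilinear_form_def by (intro continuous_intros continuous_on_product_coordinates)
  then have "continuous_on ?S (\<lambda>x. bilinear_form V b x x)"
    by (rule continuous_on_subset) simp
  ultimately obtain x where "x \<in> ?S"
    and "\<And>y. y \<in> ?S \<Longrightarrow> bilinear_form V b y y \<le> bilinear_form V b x x"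
    using continuous_attains_sup[of ?S "\<lambda>x. bilinear_form V b x x"] by blast
  then have "rayleigh_bound V b (bilinear_form V b x x)"
    using assms(1) by (intro rayleigh_bound_if_unit_sphere)
  moreover have "(\<Sum>u\<in>V. (x u)\<^sup>2) = 1" using \<open>x \<in> ?S\<close> by (simp add: unit_sphere_on_def)
  ultimately show ?thesis by (rule that[rotated])
qed

lemma linear_le_quadratic_imp_zero:
  fixes a c :: real
  assumes "\<And>t. t * a \<le> t\<^sup>2 * c"
  shows "a = 0"
proof (rule ccontr)
  assume "a \<noteq> 0"
  define e where "e = 1 / (\<bar>c\<bar> + 1)"
  have e_bounds: "e > 0" "e * c < 1" by (auto simp: e_def divide_simps)
  have "(e * a) * a \<le> (e * a)\<^sup>2 * c" by (rule assms)
  then have "a\<^sup>2 * (e * (1 - e * c)) \<le> 0" by (simp add: algebra_simps power2_eq_square)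
  moreover have "a\<^sup>2 * (e * (1 - e * c)) > 0" using \<open>a \<noteq> 0\<close> e_bounds by simp
  ultimately show False by linarith
qed

lemma rayleigh_maximizer_eigenvector:
  assumes "finite V" and sym: "symmetric_on V b"
    and bound: "rayleigh_bound V b k" and attained: "bilinear_form V b x x = k * (\<Sum>u\<in>V. (x u)\<^sup>2)"
    and "a \<in> V"
  shows "(\<Sum>w\<in>V. b a w * x w) = k * x a"
proof -
  let ?e = "\<lambda>u. of_bool (u = a) :: real"
  have form_e: "bilinear_form V b ?e y = (\<Sum>w\<in>V. b a w * y w)" for y
    using sum_of_bool_eq_mult[OF assms(1,5)] by (simp add: bilinear_form_def)
  have "t * (2 * ((\<Sum>w\<in>V. b a w * x w) - k * x a)) \<le> t\<^sup>2 * (k - b a a)" for t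
  proof -
    let ?y = "\<lambda>u. x u + t * ?e u"
    have "bilinear_form V b ?y ?y \<le> k * (\<Sum>u\<in>V. (?y u)\<^sup>2)"
      using bound by (simp add: rayleigh_bound_def)
    moreover have "bilinear_form V b ?y ?y
        = bilinear_form V b x x + 2 * t * (\<Sum>w\<in>V. b a w * x w) + t\<^sup>2 * b a a"
      using sum_of_bool_eq_mult[OF assms(1,5), of "b a"]
      unfolding bilinear_form_add_scaled[OF sym] form_e by (simp add: mult.commute)
    moreover have "(\<Sum>u\<in>V. (?y u)\<^sup>2) = (\<Sum>u\<in>V. (x u)\<^sup>2) + 2 * t * x a + t\<^sup>2"
      unfolding sum_squares_add_scaled
      using sum_of_bool_eq_mult[OF assms(1,5)] by (simp add: power2_eq_square)
    ultimately show ?thesis unfolding attained by (simp add: algebra_simps)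
  qed
  then have "2 * ((\<Sum>w\<in>V. b a w * x w) - k * x a) = 0" by (rule linear_le_quadratic_imp_zero)
  then show ?thesis by simp
qed

lemma symmetric_top_eigenvalue:
  assumes "finite V" "V \<noteq> {}" and sym: "symmetric_on V b"
  obtains k where "eigenvalue_on V b k" and "rayleigh_bound V b k"
proof -
  obtain x where unit: "(\<Sum>u\<in>V. (x u)\<^sup>2) = 1" and bound: "rayleigh_bound V b (bilinear_form V b x x)"
    using rayleigh_bound_attained[OF assms(1,2)] .
  have "\<exists>u\<in>V. x u \<noteq> 0"
  proof (rule ccontr)
    assume "\<not> ?thesis"
    then show False using unit by simp
  qed
  moreover have "\<forall>u\<in>V. (\<Sum>w\<in>V. b u w * x w) = bilinear_form V b x x * x u"
    using rayleigh_maximizer_eigenvector[OF assms(1) sym bound] unit by simp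
  ultimately show ?thesis using bound that unfolding eigenvalue_on_def by blast
qed

text \<open>
  Polarization. For a nonnegative matrix \<open>- Q(x - y) \<le> Q(|x - y|)\<close>, so the upper Rayleigh bound also
  controls the term that is subtracted.
\<close>

lemma nonneg_bilinear_form_le:
  assumes sym: "symmetric_on V b"
    and nonneg: "nonneg_on V b"
    and bound: "rayleigh_bound V b k"
  shows "2 * bilinear_form V b y x \<le> k * ((\<Sum>u\<in>V. (x u)\<^sup>2) + (\<Sum>u\<in>V. (y u)\<^sup>2))"
proof -
  let ?Q = "\<lambda>z. bilinear_form V b z z" and ?N = "\<lambda>z. \<Sum>u\<in>V. (z u)\<^sup>2"
  let ?p = "\<lambda>u. x u + 1 * y u" and ?m = "\<lambda>u. x u + -1 * y u"
  have rayleigh: "?Q z \<le> k * ?N z" for z using bound by (simp add: rayleigh_bound_def)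
  have "- ?Q ?m \<le> ?Q (\<lambda>u. \<bar>?m u\<bar>)"
    unfolding bilinear_form_def sum_distrib_left sum_negf[symmetric]
  proof (intro sum_mono)
    fix u w assume "u \<in> V" "w \<in> V"
    then have "b u w * - (?m u * ?m w) \<le> b u w * \<bar>?m u * ?m w\<bar>"
      using nonneg by (intro mult_left_mono abs_ge_minus_self) (simp add: nonneg_on_def)
    then show "- (?m u * (b u w * ?m w)) \<le> \<bar>?m u\<bar> * (b u w * \<bar>?m w\<bar>)"
      by (simp add: abs_mult mult_ac)
  qed
  then have "- ?Q ?m \<le> k * ?N ?m" using rayleigh[of "\<lambda>u. \<bar>?m u\<bar>"] by simp
  moreover have "4 * bilinear_form V b y x = ?Q ?p - ?Q ?m"
    unfolding bilinear_form_add_scaled[OF sym] by simp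
  moreover have "k * ?N ?p + k * ?N ?m = k * (2 * (?N x + ?N y))"
    unfolding sum_squares_add_scaled by (simp add: algebra_simps)
  ultimately show ?thesis using rayleigh[of ?p] by argo
qed

lemma sum_row_squares_le:
  assumes "finite V" "a \<in> V"
    and sym: "symmetric_on V b"
    and nonneg: "nonneg_on V b"
    and bound: "rayleigh_bound V b k"
  shows "(\<Sum>w\<in>V. (b a w)\<^sup>2) \<le> k\<^sup>2"
proof -
  let ?S = "\<Sum>w\<in>V. (b a w)\<^sup>2" and ?e = "\<lambda>u. of_bool (u = a) :: real"
  have scaled: "2 * (t * ?S) \<le> k * (?S + t\<^sup>2)" for t
  proof -
    have "bilinear_form V b (\<lambda>u. t * ?e u) (b a) = t * (\<Sum>u\<in>V. ?e u * (\<Sum>w\<in>V. b u w * b a w))"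
      by (simp add: bilinear_form_def sum_distrib_left mult_ac)
    also have "\<dots> = t * ?S" by (simp only: sum_of_bool_eq_mult[OF assms(1,2)] power2_eq_square)
    moreover have "(\<Sum>u\<in>V. (t * ?e u)\<^sup>2) = t\<^sup>2"
      using sum_of_bool_eq_mult[OF assms(1,2), of "\<lambda>u. t\<^sup>2 * ?e u"]
      by (simp add: power2_eq_square mult_ac)
    ultimately show ?thesis
      using nonneg_bilinear_form_le[OF sym nonneg bound, of "\<lambda>u. t * ?e u" "b a"] by simp
  qed
  have "0 \<le> b a a" using nonneg assms(2) by (simp add: nonneg_on_def)
  then have "0 \<le> k" using rayleigh_bound_diagonal[OF assms(1,2) bound] by linarith
  show ?thesis
  proof (cases "k = 0")
    case True
    then show ?thesis using scaled[of 1] by simp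
  next
    case False
    have "k * ?S \<le> k * k\<^sup>2" using scaled[of k] by (simp add: algebra_simps)
    then show ?thesis using False \<open>0 \<le> k\<close> by simp
  qed
qed

lemma eigenvalue_on_le_supervector:
  assumes "finite V" and eigenvalue: "eigenvalue_on V b k"
    and nonneg: "nonneg_on V b"
    and pos: "\<And>u. u \<in> V \<Longrightarrow> 0 < y u"
    and super: "\<And>u. u \<in> V \<Longrightarrow> (\<Sum>w\<in>V. b u w * y w) \<le> m * y u"
  shows "k \<le> m"
proof -
  obtain x where nonzero: "\<exists>u\<in>V. x u \<noteq> 0"
    and eigen: "\<And>u. u \<in> V \<Longrightarrow> (\<Sum>w\<in>V. b u w * x w) = k * x u"
    using eigenvalue_onE[OF eigenvalue] by blast
  define r where "r = Max ((\<lambda>u. \<bar>x u\<bar> / y u) ` V)"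
  have "r \<in> (\<lambda>u. \<bar>x u\<bar> / y u) ` V"
    unfolding r_def by (rule Max_in) (use nonzero assms(1) in auto)
  then obtain a where a: "a \<in> V" "\<bar>x a\<bar> = r * y a" using pos by force
  have x_le: "\<bar>x u\<bar> \<le> r * y u" if "u \<in> V" for u
  proof -
    have "\<bar>x u\<bar> / y u \<le> r" unfolding r_def using that assms(1) by (intro Max_ge) auto
    then show ?thesis using pos[OF that] by (simp add: divide_le_eq)
  qed
  obtain u where u: "u \<in> V" "x u \<noteq> 0" using nonzero by blast
  then have "0 < r * y u" using x_le[OF u(1)] by simp
  then have "0 < r" using pos[OF u(1)] by (simp add: zero_less_mult_iff)
  have "k * (r * y a) \<le> \<bar>k * x a\<bar>" by (simp add: abs_mult a(2)[symmetric] mult_right_mono)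
  also have "\<dots> \<le> (\<Sum>w\<in>V. \<bar>b a w * x w\<bar>)" unfolding eigen[OF a(1), symmetric] by (rule sum_abs)
  also have "\<dots> \<le> (\<Sum>w\<in>V. b a w * (r * y w))"
    using nonneg a(1) by (intro sum_mono) (simp add: nonneg_on_def abs_mult x_le mult_left_mono)
  also have "\<dots> = r * (\<Sum>w\<in>V. b a w * y w)" by (simp add: sum_distrib_left mult_ac)
  also have "\<dots> \<le> r * (m * y a)" using \<open>0 < r\<close> super[OF a(1)] by simp
  finally have "k * (r * y a) \<le> m * (r * y a)" by (simp add: mult_ac)
  then show ?thesis using \<open>0 < r\<close> pos[OF a(1)] by simp
qed

lemma sum_squares_two_colour_le:
  fixes x \<sigma> :: "'a \<Rightarrow> real"
  assumes "\<And>u. (\<sigma> u)\<^sup>2 = 1"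
  shows "(\<Sum>u\<in>V. \<Sum>w\<in>V. (x u * x w * (1 - \<sigma> u * \<sigma> w))\<^sup>2) \<le> 2 * (\<Sum>u\<in>V. (x u)\<^sup>2)\<^sup>2"
proof -
  have expand: "(x u * x w * (1 - \<sigma> u * \<sigma> w))\<^sup>2
      = 2 * ((x u)\<^sup>2 * (x w)\<^sup>2) - 2 * ((\<sigma> u * (x u)\<^sup>2) * (\<sigma> w * (x w)\<^sup>2))" for u w
  proof -
    have "(1 - \<sigma> u * \<sigma> w)\<^sup>2 = 2 - 2 * (\<sigma> u * \<sigma> w)"
      using assms by (simp add: power2_diff power_mult_distrib)
    then have "(x u * x w * (1 - \<sigma> u * \<sigma> w))\<^sup>2 = (x u)\<^sup>2 * (x w)\<^sup>2 * (2 - 2 * (\<sigma> u * \<sigma> w))"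
      by (simp only: power_mult_distrib)
    then show ?thesis by (simp add: algebra_simps)
  qed
  have "(\<Sum>u\<in>V. \<Sum>w\<in>V. (x u * x w * (1 - \<sigma> u * \<sigma> w))\<^sup>2)
      = 2 * (\<Sum>u\<in>V. (x u)\<^sup>2)\<^sup>2 - 2 * (\<Sum>u\<in>V. \<sigma> u * (x u)\<^sup>2)\<^sup>2"
    by (simp only: expand sum_subtractf sum_distrib_left[symmetric] sum_distrib_right[symmetric]
        power2_eq_square[of "sum _ _"])
  then show ?thesis by simp
qed

text \<open>
  Cauchy-Schwarz against the rank-two matrix \<open>x\<^sub>u x\<^sub>w (1 - \<sigma>\<^sub>u \<sigma>\<^sub>w)\<close> instead of \<open>x\<^sub>u x\<^sub>w\<close>, where \<open>\<sigma>\<close> is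
  the sign of the colour class, gains the factor 2 over the plain Frobenius bound.
\<close>

lemma eigenvalue_on_bipartite_le_frobenius:
  fixes colour :: "'a \<Rightarrow> bool"
  assumes "finite V" "eigenvalue_on V b k"
    and bipartite: "\<And>u w. u \<in> V \<Longrightarrow> w \<in> V \<Longrightarrow> b u w \<noteq> 0 \<Longrightarrow> colour u \<noteq> colour w"
  shows "2 * k\<^sup>2 \<le> (\<Sum>u\<in>V. \<Sum>w\<in>V. (b u w)\<^sup>2)"
proof -
  obtain x where nonzero: "\<exists>u\<in>V. x u \<noteq> 0"
    and eigen: "\<And>u. u \<in> V \<Longrightarrow> (\<Sum>w\<in>V. b u w * x w) = k * x u"
    using eigenvalue_onE[OF assms(2)] by blast
  define N where "N = (\<Sum>u\<in>V. (x u)\<^sup>2)"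
  have "N > 0" unfolding N_def using nonzero assms(1) by (auto intro: sum_pos2)
  define \<sigma> :: "'a \<Rightarrow> real" where "\<sigma> u = (if colour u then 1 else -1)" for u
  define M where "M u w = x u * x w * (1 - \<sigma> u * \<sigma> w)" for u w
  define S where "S = (\<Sum>(u, w)\<in>V \<times> V. (b u w)\<^sup>2)"
  have "b u w * M u w = 2 * x u * (b u w * x w)" if "u \<in> V" "w \<in> V" for u w
    using bipartite[OF that] by (cases "b u w = 0") (auto simp: M_def \<sigma>_def)
  then have "(\<Sum>u\<in>V. \<Sum>w\<in>V. b u w * M u w) = (\<Sum>u\<in>V. 2 * x u * (\<Sum>w\<in>V. b u w * x w))"
    unfolding sum_distrib_left by (intro sum.cong refl)
  also have "\<dots> = 2 * k * N"
    unfolding N_def sum_distrib_left[of "2 * k"]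
    by (rule sum.cong) (simp_all add: eigen power2_eq_square)
  finally have "(\<Sum>(u, w)\<in>V \<times> V. b u w * M u w) = 2 * k * N"
    by (simp add: sum.cartesian_product)
  then have "(2 * k * N)\<^sup>2 \<le> S * (\<Sum>(u, w)\<in>V \<times> V. (M u w)\<^sup>2)"
    using Cauchy_Schwarz_ineq_sum[of "\<lambda>(u, w). b u w" "\<lambda>(u, w). M u w" "V \<times> V"]
    by (simp add: case_prod_unfold S_def)
  also have "\<dots> \<le> S * (2 * N\<^sup>2)"
    using sum_squares_two_colour_le[of \<sigma> x V]
    by (intro mult_left_mono)
      (auto simp: S_def M_def N_def \<sigma>_def sum.cartesian_product intro: sum_nonneg)
  finally have "(2 * k\<^sup>2) * (2 * N\<^sup>2) \<le> S * (2 * N\<^sup>2)"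
    by (simp add: power2_eq_square mult_ac)
  then show ?thesis using \<open>N > 0\<close> by (simp add: S_def sum.cartesian_product)
qed

section \<open>Convex sums\<close>

lemma convex_on_add_le_endpoints:
  fixes f :: "real \<Rightarrow> real"
  assumes "convex_on {a..b} f" "a \<le> x" "x \<le> b" "x + y = a + b"
  shows "f x + f y \<le> f a + f b"
proof (cases "a = b")
  case True
  then show ?thesis using assms by auto
next
  case False
  define t where "t = (x - a) / (b - a)"
  have t_range: "0 \<le> t" "t \<le> 1" using assms False by (auto simp: t_def divide_le_eq)
  have "t * (b - a) = x - a" using False by (simp add: t_def)
  then have endpoints: "(1 - t) * a + t * b = x" "(1 - (1 - t)) * a + (1 - t) * b = y"
    using assms(4) by (simp_all add: algebra_simps)
  have "f x \<le> (1 - t) * f a + t * f b" "f y \<le> (1 - (1 - t)) * f a + (1 - t) * f b"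
    using convex_onD_Icc[OF assms(1), of t] convex_onD_Icc[OF assms(1), of "1 - t"]
      assms t_range endpoints by simp_all
  then show ?thesis by (simp add: algebra_simps)
qed

lemma convex_on_superadditive_sum:
  fixes f :: "'a \<Rightarrow> real"
  assumes "finite V" and convex: "convex_on {0..a} \<phi>" and zero: "\<phi> 0 = 0"
    and "\<And>v. v \<in> V \<Longrightarrow> 0 \<le> f v" and "sum f V \<le> a"
  shows "(\<Sum>v\<in>V. \<phi> (f v)) \<le> \<phi> (sum f V)"
  using assms(1,4,5)
proof (induction V rule: finite_induct)
  case (insert v V)
  let ?s = "f v + sum f V"
  have bounds: "0 \<le> f v" "0 \<le> sum f V" "?s \<le> a"
    using insert by (auto intro: sum_nonneg)
  have "(\<Sum>w\<in>V. \<phi> (f w)) \<le> \<phi> (sum f V)" using insert bounds by simp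
  moreover have "convex_on {0..?s} \<phi>" using convex by (rule convex_on_subset) (use bounds in auto)
  then have "\<phi> (f v) + \<phi> (sum f V) \<le> \<phi> 0 + \<phi> ?s"
    by (rule convex_on_add_le_endpoints) (use bounds in auto)
  ultimately show ?case using insert by (simp add: zero)
qed (simp add: zero)

lemma convex_on_sum_le_two_points:
  fixes f :: "'a \<Rightarrow> real"
  assumes "finite V" and convex: "convex_on {0..a} \<phi>" and zero: "\<phi> 0 = 0"
    and "\<And>v. v \<in> V \<Longrightarrow> 0 \<le> f v" "\<And>v. v \<in> V \<Longrightarrow> f v \<le> a" and "a \<le> sum f V" "sum f V \<le> 2 * a"
  shows "(\<Sum>v\<in>V. \<phi> (f v)) \<le> \<phi> a + \<phi> (sum f V - a)"
  using assms(1,4-)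
proof (induction V rule: finite_induct)
  case empty
  then show ?case by (simp add: zero)
next
  case (insert v V)
  let ?r = "sum f V" and ?s = "f v + sum f V"
  have bounds: "0 \<le> f v" "f v \<le> a" "0 \<le> ?r" "a \<le> ?s" "?s \<le> 2 * a"
    using insert by (auto intro: sum_nonneg)
  have convex_sub: "convex_on {x..y} \<phi>" if "0 \<le> x" "y \<le> a" for x y
    using convex by (rule convex_on_subset) (use that in auto)
  have "(\<Sum>w\<in>V. \<phi> (f w)) + \<phi> (f v) \<le> \<phi> a + \<phi> (?s - a)"
  proof (cases "?r \<le> a")
    case True
    then have "(\<Sum>w\<in>V. \<phi> (f w)) \<le> \<phi> ?r"
      using insert by (intro convex_on_superadditive_sum[OF _ convex zero]) auto
    moreover have "\<phi> (f v) + \<phi> ?r \<le> \<phi> (?s - a) + \<phi> a"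
      by (rule convex_on_add_le_endpoints[OF convex_sub]) (use bounds True in auto)
    ultimately show ?thesis by simp
  next
    case False
    moreover have "?r \<le> 2 * a" using bounds by linarith
    ultimately have "(\<Sum>w\<in>V. \<phi> (f w)) \<le> \<phi> a + \<phi> (?r - a)"
      using insert by (intro insert.IH) auto
    moreover have "\<phi> (f v) + \<phi> (?r - a) \<le> \<phi> 0 + \<phi> (?s - a)"
      by (rule convex_on_add_le_endpoints[OF convex_sub]) (use bounds False in auto)
    ultimately show ?thesis by (simp add: zero)
  qed
  then show ?case using insert by (simp add: add.commute)
qed

section \<open>Bounds for the extended spectral radius\<close>

abbreviation nbrs :: "'a pair_pre_digraph \<Rightarrow> 'a \<Rightarrow> 'a set" where
  "nbrs G u \<equiv> parcs G `` {u}"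

lemma out_degree_eq_card_nbrs [simp]: "out_degree (with_proj G) u = card (nbrs G u)"
proof -
  have "bij_betw (Pair u) (nbrs G u) (out_arcs (with_proj G) u)"
    by (auto simp: bij_betw_def inj_on_def out_arcs_def)
  then show ?thesis by (simp add: out_degree_def bij_betw_same_card)
qed

definition edge_weight :: "real \<Rightarrow> real \<Rightarrow> real" where
  "edge_weight a b = a / b + b / a"

lemma edge_weight_commute: "edge_weight a b = edge_weight b a"
  by (simp add: edge_weight_def add.commute)

lemma edge_weight_pos: "0 < a \<Longrightarrow> 0 < b \<Longrightarrow> 0 < edge_weight a b"
  by (simp add: edge_weight_def add_pos_pos)

lemma edge_weight_squared:
  assumes "a \<noteq> 0" "b \<noteq> 0"
  shows "(edge_weight a b)\<^sup>2 = a\<^sup>2 / b\<^sup>2 + b\<^sup>2 / a\<^sup>2 + 2"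
  using assms by (simp add: edge_weight_def power2_sum power_divide)

lemma edge_weight_squared_le:
  assumes "1 \<le> a" "1 \<le> b"
  shows "(edge_weight a b)\<^sup>2 \<le> a\<^sup>2 + b\<^sup>2 + 2"
proof -
  have "a\<^sup>2 / b\<^sup>2 \<le> a\<^sup>2" "b\<^sup>2 / a\<^sup>2 \<le> b\<^sup>2"
    using assms one_le_power[of a 2] one_le_power[of b 2]
    by (auto simp: divide_le_eq mult_le_cancel_left1)
  then show ?thesis using assms by (simp add: edge_weight_squared)
qed

lemma ext_adj_eq:
  "ext_adj G u w = (if w \<in> nbrs G u then edge_weight (deg G u) (deg G w) / 2 else 0)"
  by (simp add: ext_adj_def edge_weight_def)

lemma nonneg_on_ext_adj: "nonneg_on V (ext_adj G)"
  by (simp add: nonneg_on_def ext_adj_def)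

context pair_graph
begin

lemma nbrs_subset: "nbrs G u \<subseteq> pverts G"
  by (auto dest: in_arcsD2)

lemma finite_nbrs: "finite (nbrs G u)"
  using nbrs_subset pair_finite_verts by (rule finite_subset)

lemma nbrs_irrefl: "u \<notin> nbrs G u"
  using pair_no_loops by force

lemma symmetric_on_ext_adj: "symmetric_on V (ext_adj G)"
  unfolding symmetric_on_def
proof (intro ballI)
  fix u w
  show "ext_adj G u w = ext_adj G w u"
    using arcs_symmetric[of u w] arcs_symmetric[of w u] by (auto simp: ext_adj_def add.commute)
qed

lemma sum_nbrs:
  fixes f :: "'a \<Rightarrow> real"
  shows "(\<Sum>w\<in>pverts G. if w \<in> nbrs G u then f w else 0) = (\<Sum>w\<in>nbrs G u. f w)"
proof -
  have "pverts G \<inter> nbrs G u = nbrs G u" using nbrs_subset by blast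
  then show ?thesis by (simp only: sum.inter_restrict[OF pair_finite_verts, symmetric])
qed

lemma sum_ext_adj:
  "(\<Sum>w\<in>pverts G. ext_adj G u w * y w)
    = (\<Sum>w\<in>nbrs G u. edge_weight (deg G u) (deg G w) * y w) / 2"
  unfolding sum_nbrs[symmetric] sum_divide_distrib by (rule sum.cong) (auto simp: ext_adj_eq)

lemma
  assumes "pverts G \<noteq> {}"
  shows eigenvalue_on_ext_spectral_radius: "eigenvalue_on (pverts G) (ext_adj G) (\<eta>\<^sub>1 G)"
    and rayleigh_bound_ext_spectral_radius: "rayleigh_bound (pverts G) (ext_adj G) (\<eta>\<^sub>1 G)"
proof -
  obtain k where top: "eigenvalue_on (pverts G) (ext_adj G) k"
    "rayleigh_bound (pverts G) (ext_adj G) k"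
    using symmetric_top_eigenvalue[OF pair_finite_verts assms symmetric_on_ext_adj] .
  obtain vs where vs: "distinct vs" "set vs = pverts G"
    using finite_distinct_list[OF pair_finite_verts] by blast
  have spectrum_eq:
    "{m. eigenvalue (ext_adj_mat G vs) m} = {m. eigenvalue_on (pverts G) (ext_adj G) m}"
    unfolding eigenvalue_ext_adj_mat_iff[OF vs] eigenvalue_on_def ..
  have "finite {m. eigenvalue (ext_adj_mat G vs) m}"
    using card_finite_spectrum(1)[of "ext_adj_mat G vs" "length vs"]
    by (simp add: spectrum_def ext_adj_mat_def)
  then have "\<eta>\<^sub>1 G = k"
    unfolding ext_spectral_radius_enum[OF vs] spectrum_eq
    using top eigenvalue_on_le_rayleigh_bound[OF pair_finite_verts _ top(2)]
    by (intro Max_eqI) auto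
  then show "eigenvalue_on (pverts G) (ext_adj G) (\<eta>\<^sub>1 G)"
    and "rayleigh_bound (pverts G) (ext_adj G) (\<eta>\<^sub>1 G)"
    using top by simp_all
qed

lemma ext_spectral_radius_nonneg:
  assumes "pverts G \<noteq> {}"
  shows "0 \<le> \<eta>\<^sub>1 G"
proof -
  obtain c where "c \<in> pverts G" using assms by blast
  with pair_finite_verts have "ext_adj G c c \<le> \<eta>\<^sub>1 G"
    using rayleigh_bound_ext_spectral_radius[OF assms] by (rule rayleigh_bound_diagonal)
  moreover have "0 \<le> ext_adj G c c"
    using nonneg_on_ext_adj[of "{c}" G] by (simp add: nonneg_on_def)
  ultimately show ?thesis by linarith
qed

lemma sum_edge_weight_squares_le:
  assumes "c \<in> pverts G"
  shows "(\<Sum>w\<in>nbrs G c. (edge_weight (deg G c) (deg G w))\<^sup>2) \<le> 4 * (\<eta>\<^sub>1 G)\<^sup>2"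
proof -
  have "rayleigh_bound (pverts G) (ext_adj G) (\<eta>\<^sub>1 G)"
    using assms by (intro rayleigh_bound_ext_spectral_radius) blast
  then have "(\<Sum>w\<in>pverts G. (ext_adj G c w)\<^sup>2) \<le> (\<eta>\<^sub>1 G)\<^sup>2"
    by (intro sum_row_squares_le assms pair_finite_verts symmetric_on_ext_adj nonneg_on_ext_adj)
  moreover have "4 * (\<Sum>w\<in>pverts G. (ext_adj G c w)\<^sup>2)
      = (\<Sum>w\<in>nbrs G c. (edge_weight (deg G c) (deg G w))\<^sup>2)"
    unfolding sum_nbrs[symmetric] sum_distrib_left
    by (rule sum.cong) (auto simp: ext_adj_eq power_divide)
  ultimately show ?thesis by simp
qed

lemma sum_ext_adj_squares_le:
  "(\<Sum>u\<in>pverts G. \<Sum>w\<in>pverts G. 4 * (ext_adj G u w)\<^sup>2) \<le> 2 * (\<Sum>u\<in>pverts G. (deg G u) ^ 3 + deg G u)"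
proof -
  define g where "g u w = (if w \<in> nbrs G u then (deg G u)\<^sup>2 + 1 else 0)" for u w
  have bound: "4 * (ext_adj G u w)\<^sup>2 \<le> g u w + g w u" for u w
  proof (cases "w \<in> nbrs G u")
    case True
    then have "u \<in> nbrs G w" using arcs_symmetric by blast
    then have "1 \<le> deg G u" "1 \<le> deg G w"
      using True finite_nbrs[of u] finite_nbrs[of w] by (auto simp: Suc_le_eq card_gt_0_iff)
    then have "(edge_weight (deg G u) (deg G w))\<^sup>2 \<le> (deg G u)\<^sup>2 + (deg G w)\<^sup>2 + 2"
      by (rule edge_weight_squared_le)
    then show ?thesis using True \<open>u \<in> nbrs G w\<close> by (simp add: ext_adj_eq g_def power_divide)
  qed (simp add: ext_adj_eq g_def)
  have row: "(\<Sum>w\<in>pverts G. g u w) = (deg G u) ^ 3 + deg G u" for u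
    unfolding g_def sum_nbrs by (simp add: power2_eq_square power3_eq_cube algebra_simps)
  have "(\<Sum>u\<in>pverts G. \<Sum>w\<in>pverts G. 4 * (ext_adj G u w)\<^sup>2)
      \<le> (\<Sum>u\<in>pverts G. \<Sum>w\<in>pverts G. g u w + g w u)"
    by (intro sum_mono bound)
  also have "\<dots> = 2 * (\<Sum>u\<in>pverts G. \<Sum>w\<in>pverts G. g u w)"
    unfolding sum.distrib sum.swap[of "\<lambda>u w. g w u"] by simp
  finally show ?thesis unfolding row .
qed

lemma ext_spectral_radius_bipartite_le:
  fixes colour :: "'a \<Rightarrow> bool"
  assumes "pverts G \<noteq> {}" and bipartite: "\<And>u w. (u, w) \<in> parcs G \<Longrightarrow> colour u \<noteq> colour w"
  shows "4 * (\<eta>\<^sub>1 G)\<^sup>2 \<le> (\<Sum>u\<in>pverts G. (deg G u) ^ 3 + deg G u)"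
proof -
  have "colour u \<noteq> colour w" if "u \<in> pverts G" "w \<in> pverts G" "ext_adj G u w \<noteq> 0" for u w
    using that(3) bipartite[of u w] unfolding ext_adj_def by presburger
  with pair_finite_verts eigenvalue_on_ext_spectral_radius[OF assms(1)]
  have "2 * (\<eta>\<^sub>1 G)\<^sup>2 \<le> (\<Sum>u\<in>pverts G. \<Sum>w\<in>pverts G. (ext_adj G u w)\<^sup>2)"
    by (rule eigenvalue_on_bipartite_le_frobenius)
  then show ?thesis using sum_ext_adj_squares_le by (simp add: sum_distrib_left[symmetric])
qed

end

section \<open>Rooted trees\<close>

lemma funpow_reaches_if_decreasing:
  fixes d :: "'a \<Rightarrow> nat"
  assumes decreasing: "\<And>v. v \<in> V \<Longrightarrow> v \<noteq> c \<Longrightarrow> p v \<in> V \<and> d (p v) < d v" and "v \<in> V"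
  shows "\<exists>k. (p ^^ k) v = c"
  using assms(2)
proof (induction "d v" arbitrary: v rule: less_induct)
  case less
  show ?case
  proof (cases "v = c")
    case True
    then show ?thesis by (intro exI[of _ 0]) simp
  next
    case False
    then obtain k where "(p ^^ k) (p v) = c" using less decreasing by blast
    then show ?thesis by (intro exI[of _ "Suc k"]) (simp add: funpow_swap1)
  qed
qed

locale rooted_tree = pair_graph G for G :: "'a pair_pre_digraph" +
  fixes root :: 'a and parent :: "'a \<Rightarrow> 'a"
  assumes root_in_verts: "root \<in> pverts G"
    and parent_in_verts: "\<And>v. v \<in> pverts G \<Longrightarrow> v \<noteq> root \<Longrightarrow> parent v \<in> pverts G"
    and reaches_root: "\<And>v. v \<in> pverts G \<Longrightarrow> \<exists>k. (parent ^^ k) v = root"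
    and parcs_eq: "parcs G = (\<lambda>v. (v, parent v)) ` (pverts G - {root})
      \<union> (\<lambda>v. (parent v, v)) ` (pverts G - {root})"
begin

definition depth :: "'a \<Rightarrow> nat" where
  "depth v = (LEAST k. (parent ^^ k) v = root)"

lemma depth_eq_Suc:
  assumes "v \<in> pverts G" "v \<noteq> root"
  shows "depth v = Suc (depth (parent v))"
proof -
  obtain k where "(parent ^^ k) v = root" using reaches_root[OF assms(1)] by blast
  then have "depth v = Suc (LEAST k. (parent ^^ Suc k) v = root)"
    unfolding depth_def using assms(2) by (intro Least_Suc) auto
  then show ?thesis by (simp add: depth_def funpow_swap1)
qed

lemma parent_neq: "v \<in> pverts G \<Longrightarrow> v \<noteq> root \<Longrightarrow> parent v \<noteq> v"
  using depth_eq_Suc[of v] by auto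

lemma parent_parent_neq:
  "v \<in> pverts G \<Longrightarrow> v \<noteq> root \<Longrightarrow> parent v \<noteq> root \<Longrightarrow> parent (parent v) \<noteq> v"
  using depth_eq_Suc[of v] depth_eq_Suc[of "parent v"] parent_in_verts[of v] by auto

lemma arc_iff_parent:
  "u \<in> pverts G \<Longrightarrow> v \<in> pverts G \<Longrightarrow>
    (u, v) \<in> parcs G \<longleftrightarrow> (u \<noteq> root \<and> v = parent u) \<or> (v \<noteq> root \<and> u = parent v)"
  unfolding parcs_eq by auto

lemma nbrs_root: "nbrs G root = {v \<in> pverts G. v \<noteq> root \<and> parent v = root}"
  using arc_iff_parent[OF root_in_verts] nbrs_subset[of root] by auto

lemma arc_imp_depth_parity:
  assumes "(u, v) \<in> parcs G"
  shows "even (depth u) \<noteq> even (depth v)"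
  using assms depth_eq_Suc unfolding parcs_eq by auto

lemma nbrs_root_nonempty:
  assumes "v \<in> pverts G" "v \<noteq> root"
  shows "nbrs G root \<noteq> {}"
  using assms
proof (induction "depth v" arbitrary: v)
  case 0
  then show ?case using depth_eq_Suc by fastforce
next
  case (Suc k)
  show ?case
  proof (cases "parent v = root")
    case True
    then show ?thesis using Suc.prems by (auto simp: nbrs_root)
  next
    case False
    then show ?thesis
      using Suc.hyps(1)[of "parent v"] Suc.hyps(2) Suc.prems depth_eq_Suc parent_in_verts by simp
  qed
qed

lemma card_nbrs_pos:
  assumes "2 \<le> card (pverts G)" "v \<in> pverts G"
  shows "1 \<le> card (nbrs G v)"
proof -
  have "nbrs G v \<noteq> {}"
  proof (cases "v = root")
    case True
    have "\<not> pverts G \<subseteq> {root}" using assms(1) card_mono[of "{root}" "pverts G"] by auto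
    then show ?thesis using True nbrs_root_nonempty by blast
  next
    case False
    then show ?thesis using assms(2) parcs_eq by auto
  qed
  then show ?thesis using finite_nbrs by (simp add: Suc_le_eq card_gt_0_iff)
qed

lemma sum_card_nbrs: "(\<Sum>u\<in>pverts G. card (nbrs G u)) = 2 * (card (pverts G) - 1)"
proof -
  let ?W = "pverts G - {root}"
  have "(\<Sum>u\<in>pverts G. card (nbrs G u)) = card (Sigma (pverts G) (nbrs G))"
    using pair_finite_verts finite_nbrs by simp
  also have "Sigma (pverts G) (nbrs G) = parcs G" by (auto dest: in_arcsD1)
  also have "card (parcs G) = card ((\<lambda>v. (v, parent v)) ` ?W) + card ((\<lambda>v. (parent v, v)) ` ?W)"
    unfolding parcs_eq
  proof (rule card_Un_disjoint)
    show "(\<lambda>v. (v, parent v)) ` ?W \<inter> (\<lambda>v. (parent v, v)) ` ?W = {}"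
      using parent_parent_neq by fastforce
  qed (use pair_finite_verts in auto)
  also have "\<dots> = card ?W + card ?W"
    by (intro arg_cong2[of _ _ _ _ "(+)"] card_image) (auto simp: inj_on_def)
  finally show ?thesis using root_in_verts by (simp add: card_Diff_singleton)
qed

lemma sum_excess_degree: "(\<Sum>v\<in>pverts G. deg G v - 1) = real (card (pverts G)) - 2"
proof -
  have "1 \<le> card (pverts G)"
    using root_in_verts pair_finite_verts by (auto simp: Suc_le_eq card_gt_0_iff)
  then have "(\<Sum>v\<in>pverts G. deg G v) = 2 * (real (card (pverts G)) - 1)"
    using arg_cong[OF sum_card_nbrs, of real] by (simp add: of_nat_diff)
  then show ?thesis by (simp add: sum_subtractf)
qed

lemma card_nbrs_add_le:
  assumes "u \<in> pverts G" "v \<in> pverts G" "u \<noteq> v"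
  shows "card (nbrs G u) + card (nbrs G v) \<le> card (pverts G)"
proof -
  have "2 \<le> card (pverts G)"
    using card_mono[OF pair_finite_verts, of "{u, v}"] assms by simp
  then have "0 \<le> deg G w - 1" if "w \<in> pverts G" for w using card_nbrs_pos[OF _ that] by simp
  then have "(\<Sum>w\<in>{u, v}. deg G w - 1) \<le> (\<Sum>w\<in>pverts G. deg G w - 1)"
    using assms pair_finite_verts by (intro sum_mono2) auto
  then show ?thesis using assms(3) unfolding sum_excess_degree by simp
qed

lemma card_nbrs_less:
  assumes "v \<in> pverts G"
  shows "card (nbrs G v) < card (pverts G)"
proof -
  have "nbrs G v \<subset> pverts G" using assms nbrs_subset nbrs_irrefl by blast
  then show ?thesis by (rule psubset_card_mono[OF pair_finite_verts])
qed

text \<open>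
  The excess degrees \<open>d - 1\<close> sum to \<open>n - 2\<close>, so with maximal degree \<open>\<Delta>\<close> the convex function
  \<open>d\<^sup>3 + d\<close> has its largest sum for one vertex of degree \<open>\<Delta>\<close>, one of degree \<open>n - \<Delta>\<close> and leaves.
\<close>

lemma ext_spectral_radius_le_max_degree:
  fixes \<Delta> :: nat
  defines "n \<equiv> card (pverts G)"
  assumes "\<Delta> < n" "n \<le> 2 * \<Delta>" and max_degree: "\<And>v. v \<in> pverts G \<Longrightarrow> card (nbrs G v) \<le> \<Delta>"
  shows "4 * (\<eta>\<^sub>1 G)\<^sup>2 \<le> real \<Delta> ^ 3 + (real n - real \<Delta>) ^ 3 + 3 * real n - 4"
proof -
  define \<phi> :: "real \<Rightarrow> real" where "\<phi> x = x ^ 3 + (3 * x\<^sup>2 + 4 * x)" for x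
  have \<phi>_eq: "\<phi> (x - 1) = x ^ 3 + x - 2" for x
    by (simp add: \<phi>_def algebra_simps power2_eq_square power3_eq_cube)
  let ?a = "real \<Delta> - 1"
  have "n \<ge> 2" using assms(2,3) by linarith
  then have excess_nonneg: "0 \<le> deg G v - 1" if "v \<in> pverts G" for v
    using card_nbrs_pos[OF _ that] by (simp add: n_def)
  have "convex_on {0..?a} (\<lambda>x :: real. x ^ 3)"
    by (rule convex_on_subset[OF convex_power_odd]) auto
  moreover have "convex_on {0..?a} (\<lambda>x :: real. x\<^sup>2)"
    by (rule convex_on_subset[OF convex_power2]) auto
  ultimately have "convex_on {0..?a} \<phi>"
    unfolding \<phi>_def by (intro convex_on_add convex_on_cmul) (auto simp: convex_on_ident)
  then have "(\<Sum>v\<in>pverts G. \<phi> (deg G v - 1))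
      \<le> \<phi> ?a + \<phi> ((\<Sum>v\<in>pverts G. deg G v - 1) - ?a)"
  proof (rule convex_on_sum_le_two_points[OF pair_finite_verts])
    show "?a \<le> (\<Sum>v\<in>pverts G. deg G v - 1)" "(\<Sum>v\<in>pverts G. deg G v - 1) \<le> 2 * ?a"
      unfolding sum_excess_degree using assms(2,3) by (simp_all add: n_def)
  qed (use excess_nonneg max_degree in \<open>auto simp: \<phi>_def\<close>)
  moreover have "(\<Sum>v\<in>pverts G. deg G v - 1) - ?a = (real n - real \<Delta>) - 1"
    unfolding sum_excess_degree n_def by simp
  ultimately have "(\<Sum>v\<in>pverts G. (deg G v) ^ 3 + deg G v - 2)
      \<le> (real \<Delta> ^ 3 + real \<Delta> - 2) + ((real n - real \<Delta>) ^ 3 + (real n - real \<Delta>) - 2)"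
    by (simp only: \<phi>_eq)
  moreover have "4 * (\<eta>\<^sub>1 G)\<^sup>2 \<le> (\<Sum>v\<in>pverts G. (deg G v) ^ 3 + deg G v)"
    using root_in_verts arc_imp_depth_parity
    by (intro ext_spectral_radius_bipartite_le[of "\<lambda>u. even (depth u)"]) blast+
  ultimately show ?thesis by (simp add: sum_subtractf n_def)
qed

lemma ext_spectral_radius_le_large_degree:
  fixes c :: 'a
  defines "n \<equiv> card (pverts G)" and "\<Delta> \<equiv> card (nbrs G c)"
  assumes "c \<in> pverts G" "n \<le> 2 * \<Delta>"
  shows "4 * (\<eta>\<^sub>1 G)\<^sup>2 \<le> real \<Delta> ^ 3 + (real n - real \<Delta>) ^ 3 + 3 * real n - 4"
  unfolding n_def
proof (rule ext_spectral_radius_le_max_degree)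
  show "card (nbrs G v) \<le> \<Delta>" if "v \<in> pverts G" for v
    using card_nbrs_add_le[OF that assms(3)] assms(4) unfolding n_def \<Delta>_def by (cases "v = c") auto
qed (use card_nbrs_less[OF assms(3)] assms(4) in \<open>auto simp: n_def \<Delta>_def\<close>)

end

lemma simple_tree_no_path_around_arc:
  assumes tree: "simple_tree T" and arc: "(u, v) \<in> parcs T"
  shows "(v, u) \<notin> (parcs T - {(u, v), (v, u)})\<^sup>*"
proof
  let ?H = "\<lparr>pverts = pverts T, parcs = parcs T - {(u, v), (v, u)}\<rparr>"
  interpret T: pair_graph T using tree by (simp add: simple_tree_def)
  interpret H: pair_wf_digraph ?H by unfold_locales (auto dest: T.in_arcsD1 T.in_arcsD2)
  assume "(v, u) \<in> (parcs T - {(u, v), (v, u)})\<^sup>*"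
  then have "v \<rightarrow>\<^sup>*\<^bsub>with_proj ?H\<^esub> u" using T.in_arcsD1[OF arc] T.in_arcsD2[OF arc]
    by (simp add: H.reachable_conv)
  then obtain q where q: "H.apath v q u" using H.reachable_apath by blast
  then have path: "v \<in> pverts T" "set q \<subseteq> parcs T - {(u, v), (v, u)}" "pcas v q u"
    "distinct (pawalk_verts v q)"
    by (auto simp: H.apath_def H.awalk_def)
  have "u \<noteq> v" using T.pair_no_loops[OF arc] by simp
  have "2 \<le> length q"
  proof (cases q)
    case Nil
    then show ?thesis using path(3) \<open>u \<noteq> v\<close> by simp
  next
    case (Cons a q')
    then show ?thesis using path(2,3) by (cases q') (auto simp: prod_eq_iff)
  qed
  moreover have "T.cycle ((u, v) # q)"
    unfolding T.cycle_def T.awalk_def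
    using path arc T.in_arcsD1[OF arc] by (intro exI[of _ u]) auto
  ultimately show False using tree by (auto simp: simple_tree_def)
qed

lemma (in pair_graph) connected_imp_bfs_parent:
  assumes "connected (with_proj G)" and root: "c \<in> pverts G"
  obtains p :: "'a \<Rightarrow> 'a" and d :: "'a \<Rightarrow> nat"
  where "\<And>v. v \<in> pverts G \<Longrightarrow> v \<noteq> c \<Longrightarrow> (p v, v) \<in> parcs G \<and> d v = Suc (d (p v))"
proof -
  define d where "d v = (LEAST k. (c, v) \<in> parcs G ^^ k)" for v
  have d_le: "d v \<le> k" if "(c, v) \<in> parcs G ^^ k" for v k
    unfolding d_def using that by (rule Least_le)
  have "strongly_connected (with_proj G)"
    using assms(1) by (intro symmetric_connected_imp_strongly_connected pair_sym_arcs)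
  have d_walk: "(c, v) \<in> parcs G ^^ d v" if "v \<in> pverts G" for v
  proof -
    have "c \<rightarrow>\<^sup>*\<^bsub>with_proj G\<^esub> v"
      using \<open>strongly_connected (with_proj G)\<close> that root by (simp add: strongly_connected_def)
    then have "(c, v) \<in> (parcs G)\<^sup>*" by (simp add: reachable_conv)
    then show ?thesis unfolding d_def by (metis LeastI_ex rtrancl_imp_relpow)
  qed
  have "\<exists>w. (w, v) \<in> parcs G \<and> d v = Suc (d w)" if v: "v \<in> pverts G" "v \<noteq> c" for v
  proof (cases "d v")
    case 0
    then show ?thesis using d_walk[OF v(1)] v(2) by simp
  next
    case (Suc k)
    then obtain w where w: "(c, w) \<in> parcs G ^^ k" "(w, v) \<in> parcs G"
      using d_walk[OF v(1)] by auto
    have "(c, v) \<in> parcs G ^^ Suc (d w)" using d_walk[OF in_arcsD1[OF w(2)]] w(2) by auto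
    then have "d v \<le> Suc (d w)" by (rule d_le)
    then show ?thesis using d_le[OF w(1)] w(2) Suc by (intro exI[of _ w]) simp
  qed
  then show ?thesis using that[of _ d] by metis
qed

lemma simple_tree_arc_imp_parent:
  assumes tree: "simple_tree T"
    and parent_arc: "\<And>v. v \<in> pverts T \<Longrightarrow> v \<noteq> c \<Longrightarrow> (p v, v) \<in> parcs T"
    and reaches: "\<And>v. v \<in> pverts T \<Longrightarrow> \<exists>k. (p ^^ k) v = c"
    and arc: "(u, v) \<in> parcs T"
  shows "(v \<noteq> c \<and> u = p v) \<or> (u \<noteq> c \<and> v = p u)"
proof (rule ccontr)
  interpret T: pair_graph T using tree by (simp add: simple_tree_def)
  assume not_parent: "\<not> ?thesis"
  let ?E = "parcs T - {(u, v), (v, u)}"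
  have "sym (?E\<^sup>*)" by (intro sym_rtrancl symI) (auto intro: T.arcs_symmetric)
  have "(x, c) \<in> ?E\<^sup>*" if "x \<in> pverts T" "(p ^^ k) x = c" for x k
    using that
  proof (induction k arbitrary: x)
    case (Suc k)
    show ?case
    proof (cases "x = c")
      case False
      then have parent_arc_x: "(p x, x) \<in> parcs T" using Suc.prems(1) parent_arc by blast
      then have "(x, p x) \<in> ?E" using not_parent False T.arcs_symmetric by auto
      moreover have "(p x, c) \<in> ?E\<^sup>*"
        using T.in_arcsD1[OF parent_arc_x] Suc by (simp add: funpow_swap1)
      ultimately show ?thesis by (rule converse_rtrancl_into_rtrancl)
    qed simp
  qed simp
  then have to_root: "(x, c) \<in> ?E\<^sup>*" if "x \<in> pverts T" for x using reaches that by blast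
  have "(v, c) \<in> ?E\<^sup>*" "(c, u) \<in> ?E\<^sup>*"
    using to_root[OF T.in_arcsD2[OF arc]] to_root[OF T.in_arcsD1[OF arc]] symD[OF \<open>sym (?E\<^sup>*)\<close>]
    by blast+
  then have "(v, u) \<in> ?E\<^sup>*" by (rule rtrancl_trans)
  then show False using simple_tree_no_path_around_arc[OF tree arc] by contradiction
qed

lemma simple_tree_imp_rooted_tree:
  assumes tree: "simple_tree T" and root: "c \<in> pverts T"
  obtains p where "rooted_tree T c p"
proof -
  interpret T: pair_graph T using tree by (simp add: simple_tree_def)
  let ?V = "pverts T"
  obtain p and d :: "'a \<Rightarrow> nat"
    where "\<And>v. v \<in> ?V \<Longrightarrow> v \<noteq> c \<Longrightarrow> (p v, v) \<in> parcs T \<and> d v = Suc (d (p v))"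
    using T.connected_imp_bfs_parent[of c] tree root unfolding simple_tree_def by metis
  then have parent: "p v \<in> ?V" "(p v, v) \<in> parcs T" "d v = Suc (d (p v))"
    if "v \<in> ?V" "v \<noteq> c" for v
    using that T.in_arcsD1 by blast+
  have reaches: "\<exists>k. (p ^^ k) v = c" if "v \<in> ?V" for v
    by (rule funpow_reaches_if_decreasing[of ?V c p d]) (use parent that in auto)
  have "parcs T = (\<lambda>v. (v, p v)) ` (?V - {c}) \<union> (\<lambda>v. (p v, v)) ` (?V - {c})"
  proof (intro subset_antisym subrelI)
    fix u v assume arc: "(u, v) \<in> parcs T"
    then have "u \<in> ?V" "v \<in> ?V" by (rule T.in_arcsD1, rule T.in_arcsD2)
    then show "(u, v) \<in> (\<lambda>v. (v, p v)) ` (?V - {c}) \<union> (\<lambda>v. (p v, v)) ` (?V - {c})"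
      using simple_tree_arc_imp_parent[of T c p, OF tree parent(2) reaches arc] by blast
  qed (use parent(2) T.arcs_symmetric in auto)
  then have "rooted_tree T c p" using root parent(1) reaches by unfold_locales
  then show ?thesis by (rule that)
qed

section \<open>Isomorphism of rooted trees\<close>

lemma bij_betw_extend:
  assumes "finite V" "finite W" "card V = card W"
    and "A \<subseteq> V" "inj_on g A" "g ` A \<subseteq> W"
  obtains f where "bij_betw f V W" and "\<And>a. a \<in> A \<Longrightarrow> f a = g a"
proof -
  have "finite A" using assms(1,4) finite_subset by blast
  then have "card (V - A) = card (W - g ` A)"
    using assms by (simp add: card_Diff_subset card_image)
  then obtain h where "bij_betw h (V - A) (W - g ` A)"
    using assms(1,2) by (meson finite_Diff finite_same_card_bij)
  then have "bij_betw (\<lambda>x. if x \<in> A then g x else h x) (A \<union> (V - A)) (g ` A \<union> (W - g ` A))"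
    using assms(5) by (intro bij_betw_disjoint_Un) (auto simp: bij_betw_def)
  moreover have "A \<union> (V - A) = V" "g ` A \<union> (W - g ` A) = W" using assms(4,6) by auto
  ultimately show ?thesis using that[of "\<lambda>x. if x \<in> A then g x else h x"] by simp
qed

context rooted_tree
begin

lemma digraph_iso_if_parents_commute:
  assumes "rooted_tree H r q"
    and bij: "bij_betw f (pverts G) (pverts H)" "f root = r"
    and commute: "\<And>v. v \<in> pverts G \<Longrightarrow> v \<noteq> root \<Longrightarrow> q (f v) = f (parent v)"
  shows "digraph_iso (with_proj G) (with_proj H)"
proof -
  interpret H: rooted_tree H r q by fact
  have inj: "f u = f v \<longleftrightarrow> u = v" if "u \<in> pverts G" "v \<in> pverts G" for u v
    using bij(1) that by (auto simp: bij_betw_def inj_on_def)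
  have f_in_verts: "f v \<in> pverts H" if "v \<in> pverts G" for v
    using bij(1) that by (auto simp: bij_betw_def)
  have "u \<noteq> root \<and> v = parent u \<longleftrightarrow> f u \<noteq> r \<and> f v = q (f u)"
    if "u \<in> pverts G" "v \<in> pverts G" for u v
    using that inj[OF that(1) root_in_verts] inj[OF that(2) parent_in_verts[OF that(1)]]
      commute[OF that(1)] bij(2) by metis
  then have "\<forall>u\<in>pverts G. \<forall>v\<in>pverts G. (u, v) \<in> parcs G \<longleftrightarrow> (f u, f v) \<in> parcs H"
    using f_in_verts by (simp add: arc_iff_parent H.arc_iff_parent)
  then show ?thesis
    unfolding digraph_iso_pair_iff[OF pair_wf_digraph_axioms H.pair_wf_digraph_axioms]
    using bij(1) by blast
qed

lemma digraph_iso_extend: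
  assumes target: "rooted_tree H r q" and card: "card (pverts G) = card (pverts H)"
    and core: "A \<subseteq> pverts G" "root \<in> A" "\<And>v. v \<in> pverts G \<Longrightarrow> v \<notin> A \<Longrightarrow> parent v = root"
    and embedding: "inj_on g A" "g ` A \<subseteq> pverts H" "g root = r"
    and commute: "\<And>v. v \<in> A \<Longrightarrow> v \<noteq> root \<Longrightarrow> parent v \<in> A \<and> q (g v) = g (parent v)"
    and outside: "\<And>i. i \<in> pverts H \<Longrightarrow> i \<notin> g ` A \<Longrightarrow> q i = r"
  shows "digraph_iso (with_proj G) (with_proj H)"
proof -
  interpret H: rooted_tree H r q by fact
  obtain f where bij: "bij_betw f (pverts G) (pverts H)" and f_eq: "\<And>a. a \<in> A \<Longrightarrow> f a = g a"
    using bij_betw_extend[OF pair_finite_verts H.pair_finite_verts card core(1) embedding(1,2)]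
    by blast
  show ?thesis
  proof (rule digraph_iso_if_parents_commute[OF target bij])
    show "f root = r" using f_eq core(2) embedding(3) by simp
    show "q (f v) = f (parent v)" if v: "v \<in> pverts G" "v \<noteq> root" for v
    proof (cases "v \<in> A")
      case True
      then show ?thesis using commute[OF True v(2)] f_eq by simp
    next
      case False
      have "f v \<notin> g ` A"
      proof
        assume "f v \<in> g ` A"
        then obtain a where "a \<in> A" "f v = f a" using f_eq by auto
        then show False using bij v(1) core(1) False by (auto simp: bij_betw_def inj_on_def)
      qed
      moreover have "f v \<in> pverts H" using bij v(1) by (auto simp: bij_betw_def)
      ultimately show ?thesis
        using outside core(3)[OF v(1) False] f_eq[OF core(2)] embedding(3) by simp
    qed
  qed
qed

definition deep_verts :: "'a set" where
  "deep_verts = {v \<in> pverts G. v \<noteq> root \<and> parent v \<noteq> root}"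

lemma card_deep_verts: "card deep_verts = card (pverts G) - card (nbrs G root) - 1"
proof -
  have "deep_verts = pverts G - insert root (nbrs G root)"
    by (auto simp: deep_verts_def nbrs_root)
  moreover have "insert root (nbrs G root) \<subseteq> pverts G" using nbrs_subset root_in_verts by auto
  ultimately show ?thesis
    using finite_nbrs nbrs_irrefl by (simp add: card_Diff_subset)
qed

lemma deep_vertsD:
  assumes "v \<in> deep_verts"
  shows "v \<in> pverts G" "v \<noteq> root" "parent v \<in> pverts G" "parent v \<noteq> root" "parent v \<noteq> v"
  using assms parent_in_verts parent_neq by (auto simp: deep_verts_def)

lemma parent_eq_root: "v \<in> pverts G \<Longrightarrow> v \<noteq> root \<Longrightarrow> v \<notin> deep_verts \<Longrightarrow> parent v = root"
  by (simp add: deep_verts_def)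

end

lemma rooted_tree_graph_of_edges:
  fixes n :: nat
  assumes "0 < n" and edges: "E = (\<lambda>i. (q i, i)) ` {1..<n}"
    and parent_less: "\<And>i. 0 < i \<Longrightarrow> i < n \<Longrightarrow> q i < i"
  shows "rooted_tree (graph_of_edges {0..<n} E) 0 q"
proof -
  let ?G = "graph_of_edges {0..<n} E"
  have verts: "pverts ?G = {0..<n}" by (simp add: graph_of_edges_def)
  have q_less: "q i < n" if "0 < i" "i < n" for i
    using parent_less[OF that] that(2) by (rule less_trans)
  have "q i < n \<and> q i \<noteq> i" if "i \<in> {1..<n}" for i using parent_less[of i] that by auto
  then have "E \<subseteq> {0..<n} \<times> {0..<n}" "\<And>v. (v, v) \<notin> E"
    unfolding edges by fastforce+
  then have "pair_graph ?G" by (intro pair_graph_graph_of_edges) auto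
  moreover have "\<exists>k. (q ^^ k) i = 0" if "i < n" for i
    by (rule funpow_reaches_if_decreasing[of "{..<n}" 0 q "\<lambda>i. i"])
      (use parent_less q_less that in auto)
  moreover have "{0..<n} - {0} = {1..<n}" by auto
  then have "parcs ?G = (\<lambda>v. (v, q v)) ` (pverts ?G - {0}) \<union> (\<lambda>v. (q v, v)) ` (pverts ?G - {0})"
    unfolding verts by (auto simp: graph_of_edges_def edges)
  moreover have "q v \<in> pverts ?G" if "v \<in> pverts ?G" "v \<noteq> 0" for v
    using q_less that by (simp add: verts)
  ultimately show ?thesis
    using assms(1) by (intro rooted_tree.intro rooted_tree_axioms.intro) (simp_all add: verts)
qed

lemma rooted_tree_star: "0 < n \<Longrightarrow> rooted_tree (star n) 0 (\<lambda>i. 0)"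
  unfolding star_def by (intro rooted_tree_graph_of_edges) auto

lemma
  assumes "4 < n"
  shows rooted_tree_T1: "rooted_tree (T1 n) 0 (\<lambda>i. if i = n - 1 then n - 2 else 0)"
    and rooted_tree_T2: "rooted_tree (T2 n) 0
      (\<lambda>i. if i = n - 1 then n - 2 else if i = n - 2 then n - 3 else 0)"
    and rooted_tree_T3: "rooted_tree (T3 n) 0 (\<lambda>i. if n - 2 \<le> i then n - 3 else 0)"
    and rooted_tree_T4: "rooted_tree (T4 n) 0
      (\<lambda>i. if i = n - 1 then n - 3 else if i = n - 2 then n - 4 else 0)"
proof -
  obtain m where "n = m + 5" using le_Suc_ex[of 5 n] assms by auto
  then show "rooted_tree (T1 n) 0 (\<lambda>i. if i = n - 1 then n - 2 else 0)"
    "rooted_tree (T2 n) 0 (\<lambda>i. if i = n - 1 then n - 2 else if i = n - 2 then n - 3 else 0)"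
    "rooted_tree (T3 n) 0 (\<lambda>i. if n - 2 \<le> i then n - 3 else 0)"
    "rooted_tree (T4 n) 0 (\<lambda>i. if i = n - 1 then n - 3 else if i = n - 2 then n - 4 else 0)"
    unfolding T1_def T2_def T3_def T4_def
    by (intro rooted_tree_graph_of_edges; auto simp: image_iff split: if_splits)+
qed

lemma pverts_extremal [simp]:
  "pverts (star n) = {0..<n}" "pverts (T1 n) = {0..<n}" "pverts (T2 n) = {0..<n}"
  "pverts (T3 n) = {0..<n}" "pverts (T4 n) = {0..<n}"
  by (simp_all add: star_def T1_def T2_def T3_def T4_def graph_of_edges_def)

context rooted_tree
begin

lemma digraph_iso_star:
  assumes "card (pverts G) = n" "deep_verts = {}"
  shows "digraph_iso (with_proj G) (with_proj (star n))"
proof -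
  have pos: "0 < n" using assms(1) root_in_verts pair_finite_verts by (auto simp: card_gt_0_iff)
  show ?thesis
    by (rule digraph_iso_extend[OF rooted_tree_star[OF pos], where A = "{root}" and g = "\<lambda>_. 0"])
      (use pos assms root_in_verts parent_eq_root in auto)
qed

lemma digraph_iso_T1:
  assumes size: "4 < n" "card (pverts G) = n" and deep: "deep_verts = {z}"
  shows "digraph_iso (with_proj G) (with_proj (T1 n))"
proof -
  have verts: "z \<in> pverts G" "parent z \<in> pverts G"
    and neq: "z \<noteq> root" "parent z \<noteq> root" "parent z \<noteq> z"
    using deep_vertsD[of z] deep by simp_all
  have others: "parent v = root" if "v \<in> pverts G" "v \<noteq> root" "v \<noteq> z" for v
    using parent_eq_root that deep by simp
  obtain m where n_eq: "n = m + 5" using le_Suc_ex[of 5 n] size by auto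
  show ?thesis
    by (rule digraph_iso_extend[OF rooted_tree_T1[OF size(1)], where A = "{root, parent z, z}" and
          g = "(\<lambda>_. 0)(parent z := n - 2, z := n - 1)"])
      (auto simp: n_eq size(2) root_in_verts verts neq neq[THEN not_sym] others inj_on_def)
qed

lemma
  assumes size: "4 < n" "card (pverts G) = n" and deep: "deep_verts = {w, z}" "w \<noteq> z" "parent w \<noteq> z"
  shows digraph_iso_T2: "parent z = w \<Longrightarrow> digraph_iso (with_proj G) (with_proj (T2 n))"
    and digraph_iso_T3: "parent z = parent w \<Longrightarrow> digraph_iso (with_proj G) (with_proj (T3 n))"
    and digraph_iso_T4: "parent z \<noteq> w \<Longrightarrow> parent z \<noteq> parent w \<Longrightarrow>
      digraph_iso (with_proj G) (with_proj (T4 n))"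
proof -
  have verts: "w \<in> pverts G" "z \<in> pverts G" "parent w \<in> pverts G" "parent z \<in> pverts G"
    and neq: "w \<noteq> z" "w \<noteq> root" "z \<noteq> root" "parent w \<noteq> z" "parent w \<noteq> root" "parent w \<noteq> w"
      "parent z \<noteq> root" "parent z \<noteq> z"
    using deep_vertsD[of w] deep_vertsD[of z] deep by simp_all
  have others: "parent v = root" if "v \<in> pverts G" "v \<noteq> root" "v \<noteq> w" "v \<noteq> z" for v
    using parent_eq_root that deep by simp
  obtain m where n_eq: "n = m + 5" using le_Suc_ex[of 5 n] size by auto
  note facts = n_eq size(2) root_in_verts verts neq neq[THEN not_sym] others inj_on_def
  show "digraph_iso (with_proj G) (with_proj (T2 n))" if "parent z = w"
    by (rule digraph_iso_extend[OF rooted_tree_T2[OF size(1)],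
          where A = "{root, parent w, w, z}"
            and g = "(\<lambda>_. 0)(parent w := n - 3, w := n - 2, z := n - 1)"])
      (auto simp: facts that)
  show "digraph_iso (with_proj G) (with_proj (T3 n))" if "parent z = parent w"
    by (rule digraph_iso_extend[OF rooted_tree_T3[OF size(1)],
          where A = "{root, parent w, w, z}"
            and g = "(\<lambda>_. 0)(parent w := n - 3, w := n - 2, z := n - 1)"])
      (auto simp: facts that)
  show "digraph_iso (with_proj G) (with_proj (T4 n))" if "parent z \<noteq> w" "parent z \<noteq> parent w"
    by (rule digraph_iso_extend[OF rooted_tree_T4[OF size(1)],
          where A = "{root, parent w, parent z, w, z}" and
          g = "(\<lambda>_. 0)(parent w := n - 4, parent z := n - 3, w := n - 2, z := n - 1)"])
      (auto simp: facts that that[THEN not_sym])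
qed

lemma digraph_iso_of_large_degree:
  assumes size: "4 < n" "card (pverts G) = n" and degree: "n - 3 \<le> card (nbrs G root)"
  shows "\<exists>H\<in>{star n, T1 n, T2 n, T3 n, T4 n}. digraph_iso (with_proj G) (with_proj H)"
proof -
  have "card deep_verts = 0 \<or> card deep_verts = 1 \<or> card deep_verts = 2"
    using card_deep_verts size degree by linarith
  moreover have "finite deep_verts" using pair_finite_verts by (simp add: deep_verts_def)
  ultimately consider "deep_verts = {}" | z where "deep_verts = {z}"
    | w z where "deep_verts = {w, z}" "w \<noteq> z"
    by (auto simp: card_1_singleton_iff card_2_iff)
  then show ?thesis
  proof cases
    case 1
    then show ?thesis using digraph_iso_star[OF size(2)] by blast
  next
    case (2 z)
    then show ?thesis using digraph_iso_T1[OF size] by blast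
  next
    case (3 w z)
    then have "parent w \<noteq> z \<or> parent z \<noteq> w"
      using parent_parent_neq[of w] deep_vertsD[of w] by auto
    then show ?thesis
      using 3 digraph_iso_T2[OF size, of w z] digraph_iso_T2[OF size, of z w]
        digraph_iso_T3[OF size, of w z] digraph_iso_T4[OF size, of w z]
      by (auto simp: insert_commute)
  qed
qed

end

section \<open>Vertices with two degrees among their neighbours\<close>

definition hub_weight :: "nat \<Rightarrow> nat \<Rightarrow> nat \<Rightarrow> real" where
  "hub_weight l m e = real l * (edge_weight (real l + real m) 1)\<^sup>2
     + real m * (edge_weight (real l + real m) (real e))\<^sup>2"

lemma hub_weight_eq:
  assumes "0 < l + m" "0 < e" and D_eq: "D = real l + real m"
  shows "hub_weight l m e
    = (real l + real m / (real e)\<^sup>2) * D\<^sup>2 + 2 * D + (real l + real m * (real e)\<^sup>2) / D\<^sup>2"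
proof -
  have "D \<noteq> 0" using assms by auto
  then have "hub_weight l m e = real l * (D\<^sup>2 + 1 / D\<^sup>2 + 2)
      + real m * (D\<^sup>2 / (real e)\<^sup>2 + (real e)\<^sup>2 / D\<^sup>2 + 2)"
    using assms(2) by (simp add: hub_weight_def edge_weight_squared flip: D_eq)
  then show ?thesis by (simp add: D_eq algebra_simps add_divide_distrib)
qed

locale hub = pair_graph G for G :: "'a pair_pre_digraph" +
  fixes c :: 'a and L U :: "'a set" and e :: nat
  assumes hub_in_verts: "c \<in> pverts G"
    and nbrs_hub: "nbrs G c = L \<union> U" and disjoint: "L \<inter> U = {}"
    and card_nbrs_L: "\<And>v. v \<in> L \<Longrightarrow> card (nbrs G v) = 1"
    and card_nbrs_U: "\<And>v. v \<in> U \<Longrightarrow> card (nbrs G v) = e"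
begin

lemma finite_L: "finite L" and finite_U: "finite U"
  using finite_nbrs[of c] nbrs_hub by auto

lemma card_nbrs_hub: "card (nbrs G c) = card L + card U"
  unfolding nbrs_hub by (rule card_Un_disjoint[OF finite_L finite_U disjoint])

lemma hub_notin: "c \<notin> L" "c \<notin> U"
  using nbrs_irrefl[of c] nbrs_hub by auto

lemma hub_weight_le: "hub_weight (card L) (card U) e \<le> 4 * (\<eta>\<^sub>1 G)\<^sup>2"
proof -
  have "(\<Sum>w\<in>nbrs G c. (edge_weight (deg G c) (deg G w))\<^sup>2) = hub_weight (card L) (card U) e"
    unfolding nbrs_hub sum.union_disjoint[OF finite_L finite_U disjoint]
    by (simp add: card_nbrs_hub card_nbrs_L card_nbrs_U hub_weight_def)
  then show ?thesis using sum_edge_weight_squares_le[OF hub_in_verts] by simp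
qed

end

lemma eq_singleton_if_card_1:
  assumes "u \<in> A" "card A = 1"
  shows "A = {u}"
  using assms by (metis card_1_singletonE singletonD)

locale two_level_tree = hub +
  assumes e_pos: "0 < e"
    and card_nbrs_outer: "\<And>u v. u \<in> U \<Longrightarrow> v \<in> nbrs G u \<Longrightarrow> v \<noteq> c \<Longrightarrow> card (nbrs G v) = 1"
    and pverts_subset: "pverts G \<subseteq> {c} \<union> L \<union> U \<union> (\<Union>u\<in>U. nbrs G u)"
begin

lemma nbrs_L: "v \<in> L \<Longrightarrow> nbrs G v = {c}"
  using nbrs_hub arcs_symmetric card_nbrs_L by (intro eq_singleton_if_card_1) auto

lemma hub_in_nbrs_U: "u \<in> U \<Longrightarrow> c \<in> nbrs G u"
  using nbrs_hub arcs_symmetric by auto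

lemma nbrs_outer: "u \<in> U \<Longrightarrow> v \<in> nbrs G u \<Longrightarrow> v \<noteq> c \<Longrightarrow> nbrs G v = {u}"
  using arcs_symmetric card_nbrs_outer by (intro eq_singleton_if_card_1) auto

lemma outer_notin:
  assumes "u \<in> U" "v \<in> nbrs G u" "v \<noteq> c"
  shows "v \<notin> L" "v \<notin> U"
  using nbrs_outer[OF assms] nbrs_L[of v] hub_in_nbrs_U[of v] assms hub_notin by auto

definition level_vec :: "real \<Rightarrow> real \<Rightarrow> real \<Rightarrow> real \<Rightarrow> 'a \<Rightarrow> real" where
  "level_vec a b g h v = (if v = c then a else if v \<in> L then b else if v \<in> U then g else h)"

lemma level_vec_simps:
  "level_vec a b g h c = a"
  "v \<in> L \<Longrightarrow> level_vec a b g h v = b"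
  "v \<in> U \<Longrightarrow> level_vec a b g h v = g"
  "u \<in> U \<Longrightarrow> v \<in> nbrs G u \<Longrightarrow> v \<noteq> c \<Longrightarrow> level_vec a b g h v = h"
  using hub_notin disjoint outer_notin by (auto simp: level_vec_def)

abbreviation hub_degree :: real where
  "hub_degree \<equiv> real (card L) + real (card U)"

abbreviation leaf_weight :: real where
  "leaf_weight \<equiv> edge_weight hub_degree 1"

abbreviation branch_weight :: real where
  "branch_weight \<equiv> edge_weight hub_degree (real e)"

abbreviation outer_weight :: real where
  "outer_weight \<equiv> edge_weight (real e) 1"

definition outer_weight_sum :: real where
  "outer_weight_sum = (real e - 1) * outer_weight\<^sup>2"

lemma
  fixes a b g h :: real
  defines "row_sum \<equiv> \<lambda>v. \<Sum>w\<in>nbrs G v. edge_weight (deg G v) (deg G w) * level_vec a b g h w"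
  shows level_sum_hub:
      "row_sum c = real (card L) * leaf_weight * b + real (card U) * branch_weight * g"
    and level_sum_L: "v \<in> L \<Longrightarrow> row_sum v = leaf_weight * a"
    and level_sum_U: "u \<in> U \<Longrightarrow> row_sum u = branch_weight * a + (real e - 1) * outer_weight * h"
    and level_sum_outer:
      "u \<in> U \<Longrightarrow> v \<in> nbrs G u \<Longrightarrow> v \<noteq> c \<Longrightarrow> row_sum v = outer_weight * g"
proof -
  show "row_sum c = real (card L) * leaf_weight * b + real (card U) * branch_weight * g"
    unfolding row_sum_def nbrs_hub sum.union_disjoint[OF finite_L finite_U disjoint]
    by (simp add: card_nbrs_hub card_nbrs_L card_nbrs_U level_vec_simps)
  show "row_sum v = leaf_weight * a" if "v \<in> L"
    unfolding row_sum_def using that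
    by (simp add: nbrs_L card_nbrs_hub level_vec_simps edge_weight_commute[of 1])
  show "row_sum u = branch_weight * a + (real e - 1) * outer_weight * h" if "u \<in> U"
  proof -
    let ?outer = "nbrs G u - {c}"
    have "card ?outer = e - 1"
      using that hub_in_nbrs_U finite_nbrs by (simp add: card_Diff_singleton card_nbrs_U)
    moreover have "(\<Sum>w\<in>?outer. edge_weight (deg G u) (deg G w) * level_vec a b g h w)
        = (\<Sum>w\<in>?outer. outer_weight * h)"
      by (rule sum.cong) (use that in \<open>auto simp: card_nbrs_U card_nbrs_outer level_vec_simps\<close>)
    ultimately show ?thesis
      unfolding row_sum_def sum.remove[OF finite_nbrs hub_in_nbrs_U[OF that]]
      using that e_pos
      by (simp add: card_nbrs_U card_nbrs_hub level_vec_simps of_nat_diff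
          edge_weight_commute[of e hub_degree])
  qed
  show "row_sum v = outer_weight * g" if "u \<in> U" "v \<in> nbrs G u" "v \<noteq> c"
    unfolding row_sum_def using that(1)
    by (simp add: nbrs_outer[OF that] card_nbrs_U level_vec_simps edge_weight_commute[of 1])
qed

text \<open>
  This vector solves the eigenvalue equation with \<open>4 \<lambda>\<^sup>2 = m\<close> at every vertex except \<open>c\<close>.
\<close>

definition test_vec :: "real \<Rightarrow> 'a \<Rightarrow> real" where
  "test_vec m = level_vec (sqrt m * (m - outer_weight_sum)) (leaf_weight * (m - outer_weight_sum))
     (branch_weight * m) (outer_weight * branch_weight * sqrt m)"

lemma test_vec_pos:
  assumes "0 < card L + card U" "outer_weight_sum < m"
  shows "0 < test_vec m v"
proof -
  have "0 < hub_degree" using assms(1) by linarith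
  then have "0 < leaf_weight" "0 < branch_weight" "0 < outer_weight"
    using e_pos by (simp_all add: edge_weight_pos)
  moreover have "0 \<le> outer_weight_sum" using e_pos by (simp add: outer_weight_sum_def)
  ultimately show ?thesis using assms(2) by (simp add: test_vec_def level_vec_def)
qed

lemma test_vec_supersolution:
  assumes "0 \<le> m" and "v \<in> pverts G"
    and hub: "real (card L) * leaf_weight\<^sup>2 * (m - outer_weight_sum)
      + real (card U) * branch_weight\<^sup>2 * m \<le> m * (m - outer_weight_sum)"
  shows "(\<Sum>w\<in>nbrs G v. edge_weight (deg G v) (deg G w) * test_vec m w) \<le> sqrt m * test_vec m v"
proof -
  let ?k = "sqrt m" and ?r = "m - outer_weight_sum"
  have sqrt_square: "?k * ?k = m" using assms(1) by simp
  consider "v = c" | "v \<in> L" | "v \<in> U" | u where "u \<in> U" "v \<in> nbrs G u" "v \<noteq> c"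
    using pverts_subset assms(2) by blast
  then show ?thesis
  proof cases
    case 1
    have "real (card L) * leaf_weight * (leaf_weight * ?r)
        + real (card U) * branch_weight * (branch_weight * m) \<le> m * ?r"
      using hub by (simp add: power2_eq_square mult_ac)
    also have "\<dots> = ?k * (?k * ?r)" by (simp only: sqrt_square mult.assoc[symmetric])
    finally show ?thesis
      using 1 unfolding test_vec_def by (simp only: level_sum_hub level_vec_simps)
  next
    case 2
    then show ?thesis
      unfolding test_vec_def
      by (simp only: level_sum_L level_vec_simps mult.left_commute order.refl)
  next
    case 3
    have "branch_weight * (?k * ?r)
        + (real e - 1) * outer_weight * (outer_weight * branch_weight * ?k)
        = ?k * (branch_weight * m)"
      by (simp add: outer_weight_sum_def power2_eq_square algebra_simps)
    then show ?thesis
      using 3 unfolding test_vec_def by (simp only: level_sum_U level_vec_simps)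
  next
    case (4 u)
    have "outer_weight * (branch_weight * (?k * ?k)) = ?k * (outer_weight * branch_weight * ?k)"
      by (simp only: mult_ac)
    then have "outer_weight * (branch_weight * m) = ?k * (outer_weight * branch_weight * ?k)"
      by (simp only: sqrt_square)
    then show ?thesis
      unfolding test_vec_def
      by (simp only: level_sum_outer[OF 4] level_vec_simps(3)[OF 4(1)] level_vec_simps(4)[OF 4]
          order.refl)
  qed
qed

lemma ext_spectral_radius_le_two_level:
  assumes "0 < card L + card U" "outer_weight_sum < m"
    and "real (card L) * leaf_weight\<^sup>2 * (m - outer_weight_sum)
      + real (card U) * branch_weight\<^sup>2 * m \<le> m * (m - outer_weight_sum)"
  shows "4 * (\<eta>\<^sub>1 G)\<^sup>2 \<le> m"
proof -
  have "0 \<le> outer_weight_sum" using e_pos by (simp add: outer_weight_sum_def)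
  then have "0 \<le> m" using assms(2) by simp
  have nonempty: "pverts G \<noteq> {}" using hub_in_verts by blast
  have "\<eta>\<^sub>1 G \<le> sqrt m / 2"
    using pair_finite_verts eigenvalue_on_ext_spectral_radius[OF nonempty] nonneg_on_ext_adj
  proof (rule eigenvalue_on_le_supervector)
    show "0 < test_vec m v" for v using assms(1,2) by (rule test_vec_pos)
    show "(\<Sum>w\<in>pverts G. ext_adj G v w * test_vec m w) \<le> sqrt m / 2 * test_vec m v"
      if "v \<in> pverts G" for v
      using test_vec_supersolution[OF \<open>0 \<le> m\<close> that assms(3)] by (simp add: sum_ext_adj)
  qed
  then have "(\<eta>\<^sub>1 G)\<^sup>2 \<le> (sqrt m / 2)\<^sup>2"
    using ext_spectral_radius_nonneg[OF nonempty] by (rule power_mono)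
  then show ?thesis using \<open>0 \<le> m\<close> by (simp add: power_divide)
qed

lemma ext_spectral_radius_le_hub_weight:
  defines "m \<equiv> hub_weight (card L) (card U) e + 1"
  assumes "0 < card L + card U" "outer_weight_sum < m"
    and "outer_weight_sum * (real (card U) * branch_weight\<^sup>2 + 1) \<le> m"
  shows "4 * (\<eta>\<^sub>1 G)\<^sup>2 \<le> m"
  using assms(2,3)
proof (rule ext_spectral_radius_le_two_level)
  let ?A = "real (card L) * leaf_weight\<^sup>2" and ?B = "real (card U) * branch_weight\<^sup>2"
  have leaves: "?A = m - ?B - 1" by (simp add: m_def hub_weight_def)
  show "?A * (m - outer_weight_sum) + ?B * m \<le> m * (m - outer_weight_sum)"
    unfolding leaves using assms(4) by (simp add: algebra_simps)
qed

end

section \<open>The extremal trees\<close>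

lemma hub_star:
  assumes "0 < n"
  shows "hub (star n) 0 {1..<n} {} 1"
proof -
  interpret rooted_tree "star n" 0 "\<lambda>i. 0" using assms by (rule rooted_tree_star)
  have "nbrs (star n) 0 = {1..<n}" "\<And>v. v \<in> {1..<n} \<Longrightarrow> nbrs (star n) v = {0}"
    by (auto simp: star_def graph_of_edges_def)
  then show ?thesis using root_in_verts by unfold_locales auto
qed

lemma nbrs_T1:
  assumes "4 < n"
  shows "nbrs (T1 n) 0 = {1..n - 3} \<union> {n - 2}"
    and "\<And>v. v \<in> {1..n - 3} \<Longrightarrow> nbrs (T1 n) v = {0}"
    and "nbrs (T1 n) (n - 2) = {0, n - 1}"
  using assms by (auto simp: T1_def graph_of_edges_def)

lemma nbrs_T2:
  assumes "4 < n"
  shows "nbrs (T2 n) 0 = {1..n - 4} \<union> {n - 3}"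
    and "\<And>v. v \<in> {1..n - 4} \<Longrightarrow> nbrs (T2 n) v = {0}"
    and "nbrs (T2 n) (n - 3) = {0, n - 2}"
  using assms by (auto simp: T2_def graph_of_edges_def)

lemma nbrs_T3:
  assumes "4 < n"
  shows "nbrs (T3 n) 0 = {1..n - 4} \<union> {n - 3}"
    and "\<And>v. v \<in> {1..n - 4} \<Longrightarrow> nbrs (T3 n) v = {0}"
    and "nbrs (T3 n) (n - 3) = {0, n - 2, n - 1}"
    and "\<And>v. v \<in> {n - 2, n - 1} \<Longrightarrow> nbrs (T3 n) v = {n - 3}"
  using assms by (auto simp: T3_def graph_of_edges_def)

lemma nbrs_T4:
  assumes "4 < n"
  shows "nbrs (T4 n) 0 = {1..n - 5} \<union> {n - 4, n - 3}"
    and "\<And>v. v \<in> {1..n - 5} \<Longrightarrow> nbrs (T4 n) v = {0}"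
    and "nbrs (T4 n) (n - 4) = {0, n - 2}"
    and "nbrs (T4 n) (n - 3) = {0, n - 1}"
    and "nbrs (T4 n) (n - 2) = {n - 4}"
    and "nbrs (T4 n) (n - 1) = {n - 3}"
  using assms by (auto simp: T4_def graph_of_edges_def)

lemma hub_T1:
  assumes "4 < n"
  shows "hub (T1 n) 0 {1..n - 3} {n - 2} 2"
proof (intro hub.intro hub_axioms.intro)
  note nbrs = nbrs_T1[OF assms]
  show "pair_graph (T1 n)" using assms by (rule pair_graph_T1)
  show "nbrs (T1 n) 0 = {1..n - 3} \<union> {n - 2}" by (rule nbrs)
  show "card (nbrs (T1 n) v) = 1" if "v \<in> {1..n - 3}" for v using nbrs(2)[OF that] by simp
  show "card (nbrs (T1 n) v) = 2" if "v \<in> {n - 2}" for v using nbrs(3) that assms by simp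
qed (use assms in auto)

lemma hub_T2:
  assumes "4 < n"
  shows "hub (T2 n) 0 {1..n - 4} {n - 3} 2"
proof (intro hub.intro hub_axioms.intro)
  note nbrs = nbrs_T2[OF assms]
  show "pair_graph (T2 n)" using assms by (rule pair_graph_T2)
  show "nbrs (T2 n) 0 = {1..n - 4} \<union> {n - 3}" by (rule nbrs)
  show "card (nbrs (T2 n) v) = 1" if "v \<in> {1..n - 4}" for v using nbrs(2)[OF that] by simp
  show "card (nbrs (T2 n) v) = 2" if "v \<in> {n - 3}" for v using nbrs(3) that assms by simp
qed (use assms in auto)

lemma two_level_tree_T3:
  assumes "4 < n"
  shows "two_level_tree (T3 n) 0 {1..n - 4} {n - 3} 3"
proof (intro two_level_tree.intro two_level_tree_axioms.intro hub.intro hub_axioms.intro)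
  note nbrs = nbrs_T3[OF assms]
  show "pair_graph (T3 n)" using assms by (rule pair_graph_T3)
  show "nbrs (T3 n) 0 = {1..n - 4} \<union> {n - 3}" by (rule nbrs)
  show "card (nbrs (T3 n) v) = 1" if "v \<in> {1..n - 4}" for v using nbrs(2)[OF that] by simp
  show "card (nbrs (T3 n) v) = 3" if "v \<in> {n - 3}" for v using nbrs(3) that assms by simp
  show "card (nbrs (T3 n) v) = 1" if "u \<in> {n - 3}" "v \<in> nbrs (T3 n) u" "v \<noteq> 0" for u v
  proof -
    have "v \<in> {n - 2, n - 1}" using that nbrs(3) by simp
    then show ?thesis using nbrs(4)[of v] by simp
  qed
  have "{0..<n} \<subseteq> {0} \<union> {1..n - 4} \<union> {n - 3, n - 2, n - 1}" by auto
  then show "pverts (T3 n) \<subseteq> {0} \<union> {1..n - 4} \<union> {n - 3} \<union> (\<Union>u\<in>{n - 3}. nbrs (T3 n) u)"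
    using nbrs(3) by simp blast
qed (use assms in auto)

lemma two_level_tree_T4:
  assumes "4 < n"
  shows "two_level_tree (T4 n) 0 {1..n - 5} {n - 4, n - 3} 2"
proof (intro two_level_tree.intro two_level_tree_axioms.intro hub.intro hub_axioms.intro)
  note nbrs = nbrs_T4[OF assms]
  show "pair_graph (T4 n)" using assms by (rule pair_graph_T4)
  show "nbrs (T4 n) 0 = {1..n - 5} \<union> {n - 4, n - 3}" by (rule nbrs)
  show "card (nbrs (T4 n) v) = 1" if "v \<in> {1..n - 5}" for v using nbrs(2)[OF that] by simp
  show "card (nbrs (T4 n) v) = 2" if "v \<in> {n - 4, n - 3}" for v using nbrs(3,4) that assms by auto
  show "card (nbrs (T4 n) v) = 1" if "u \<in> {n - 4, n - 3}" "v \<in> nbrs (T4 n) u" "v \<noteq> 0" for u v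
  proof -
    have "v \<in> {n - 2, n - 1}" using that nbrs(3,4) by (metis insertE insertI1 insertI2 singletonD)
    then show ?thesis using nbrs(5,6) by (elim insertE) simp_all
  qed
  have "{0..<n} \<subseteq> {0} \<union> {1..n - 5} \<union> {n - 4, n - 3, n - 2, n - 1}" by auto
  then show "pverts (T4 n) \<subseteq> {0} \<union> {1..n - 5} \<union> {n - 4, n - 3} \<union> (\<Union>u\<in>{n - 4, n - 3}. nbrs (T4 n) u)"
    using nbrs(3,4) by simp blast
qed (use assms in auto)

lemma (in pair_graph) ext_spectral_radius_less_of_squares:
  assumes "pverts G \<noteq> {}" "4 * x\<^sup>2 \<le> a" "a < b" "b \<le> 4 * (\<eta>\<^sub>1 G)\<^sup>2"
  shows "x < \<eta>\<^sub>1 G"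
  using power2_less_imp_less[of x "\<eta>\<^sub>1 G"] ext_spectral_radius_nonneg[OF assms(1)] assms(2-)
  by linarith

lemma ext_spectral_radius_T1_less_star:
  assumes n_ge: "4 < n"
  shows "\<eta>\<^sub>1 (T1 n) < \<eta>\<^sub>1 (star n)"
proof -
  interpret star: hub "star n" 0 "{1..<n}" "{}" 1 using n_ge by (intro hub_star) simp
  interpret T1: hub "T1 n" 0 "{1..n - 3}" "{n - 2}" 2 using n_ge by (rule hub_T1)
  interpret T1: rooted_tree "T1 n" 0 "\<lambda>i. if i = n - 1 then n - 2 else 0"
    using n_ge by (rule rooted_tree_T1)
  define D where "D = real n - 2"
  have D_ge: "3 \<le> D" using n_ge by (simp add: D_def)
  have degree: "card (nbrs (T1 n) 0) = n - 2" using n_ge by (simp add: T1.card_nbrs_hub)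
  show ?thesis
  proof (rule star.ext_spectral_radius_less_of_squares)
    show "4 * (\<eta>\<^sub>1 (T1 n))\<^sup>2 \<le> D ^ 3 + 8 + 3 * (D + 2) - 4"
      using T1.ext_spectral_radius_le_large_degree[of 0] n_ge
      by (simp add: degree D_def of_nat_diff)
    show "hub_weight (n - 1) 0 1 \<le> 4 * (\<eta>\<^sub>1 (star n))\<^sup>2" using star.hub_weight_le by simp
    have "(D + 1) * (D + 1)\<^sup>2 + 2 * (D + 1) \<le> hub_weight (n - 1) 0 1"
      using hub_weight_eq[of "n - 1" 0 1 "D + 1"] n_ge by (simp add: D_def of_nat_diff)
    moreover have "D ^ 3 + 8 + 3 * (D + 2) - 4 < (D + 1) * (D + 1)\<^sup>2 + 2 * (D + 1)"
      using mult_mono[OF D_ge D_ge] D_ge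
      by (simp add: algebra_simps power2_eq_square power3_eq_cube)
    ultimately show "D ^ 3 + 8 + 3 * (D + 2) - 4 < hub_weight (n - 1) 0 1" by linarith
  qed (use n_ge in simp)
qed

lemma ext_spectral_radius_T2_less_T1:
  assumes n_ge: "7 \<le> n"
  shows "\<eta>\<^sub>1 (T2 n) < \<eta>\<^sub>1 (T1 n)"
proof -
  have "4 < n" using n_ge by simp
  interpret T1: hub "T1 n" 0 "{1..n - 3}" "{n - 2}" 2 using \<open>4 < n\<close> by (rule hub_T1)
  interpret T2: hub "T2 n" 0 "{1..n - 4}" "{n - 3}" 2 using \<open>4 < n\<close> by (rule hub_T2)
  interpret T2: rooted_tree "T2 n" 0
    "\<lambda>i. if i = n - 1 then n - 2 else if i = n - 2 then n - 3 else 0"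
    using \<open>4 < n\<close> by (rule rooted_tree_T2)
  define D where "D = real n - 3"
  have D_ge: "4 \<le> D" using n_ge by (simp add: D_def)
  have degree: "card (nbrs (T2 n) 0) = n - 3" using n_ge by (simp add: T2.card_nbrs_hub)
  show ?thesis
  proof (rule T1.ext_spectral_radius_less_of_squares)
    show "4 * (\<eta>\<^sub>1 (T2 n))\<^sup>2 \<le> D ^ 3 + 27 + 3 * (D + 3) - 4"
      using T2.ext_spectral_radius_le_large_degree[of 0] n_ge
      by (simp add: degree D_def of_nat_diff)
    show "hub_weight (n - 3) 1 2 \<le> 4 * (\<eta>\<^sub>1 (T1 n))\<^sup>2" using T1.hub_weight_le by simp
    have "(D + 1 / 4) * (D + 1)\<^sup>2 + 2 * (D + 1) \<le> hub_weight (n - 3) 1 2"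
      using hub_weight_eq[of "n - 3" 1 2 "D + 1"] n_ge by (simp add: D_def of_nat_diff)
    moreover have "D ^ 3 + 27 + 3 * (D + 3) - 4 < (D + 1 / 4) * (D + 1)\<^sup>2 + 2 * (D + 1)"
      using mult_mono[OF D_ge D_ge] D_ge
      by (simp add: algebra_simps power2_eq_square power3_eq_cube)
    ultimately show "D ^ 3 + 27 + 3 * (D + 3) - 4 < hub_weight (n - 3) 1 2" by linarith
  qed (use n_ge in simp)
qed

lemma hub_weight_one_two_eq:
  assumes "4 < n" "D = real n - 3"
  shows "hub_weight (n - 4) 1 2 = (D - 3 / 4) * D\<^sup>2 + 2 * D + (D + 3) / D\<^sup>2"
  using hub_weight_eq[of "n - 4" 1 2 D] assms by (simp add: of_nat_diff)

lemma hub_weight_one_three_eq: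
  assumes "4 < n" "D = real n - 3"
  shows "hub_weight (n - 4) 1 3 = (D - 8 / 9) * D\<^sup>2 + 2 * D + (D + 8) / D\<^sup>2"
  using hub_weight_eq[of "n - 4" 1 3 D] assms by (simp add: of_nat_diff)

lemma hub_weight_two_two_eq:
  assumes "4 < n" "D = real n - 3"
  shows "hub_weight (n - 5) 2 2 = (D - 3 / 2) * D\<^sup>2 + 2 * D + (D + 6) / D\<^sup>2"
  using hub_weight_eq[of "n - 5" 2 2 D] assms by (simp add: of_nat_diff)

lemma ext_spectral_radius_T3_le:
  assumes n_ge: "9 \<le> n"
  shows "4 * (\<eta>\<^sub>1 (T3 n))\<^sup>2 \<le> hub_weight (n - 4) 1 3 + 1"
proof -
  have "4 < n" using n_ge by simp
  interpret two_level_tree "T3 n" 0 "{1..n - 4}" "{n - 3}" 3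
    using \<open>4 < n\<close> by (rule two_level_tree_T3)
  define D where "D = real n - 3"
  have D_ge: "6 \<le> D" using n_ge by (simp add: D_def)
  have D_sq: "36 \<le> D\<^sup>2" using power_mono[OF D_ge, of 2] by simp
  have "5 * D\<^sup>2 + D\<^sup>2 / 9 \<le> (D - 8 / 9) * D\<^sup>2"
    using mult_right_mono[OF D_ge, of "D\<^sup>2"] by (simp add: algebra_simps)
  moreover have "0 \<le> (D + 8) / D\<^sup>2" using D_ge by simp
  ultimately have weight: "5 * D\<^sup>2 + D\<^sup>2 / 9 + 12 \<le> hub_weight (n - 4) 1 3"
    using D_ge unfolding hub_weight_one_three_eq[OF \<open>4 < n\<close> D_def] by linarith
  have "9 / D\<^sup>2 \<le> 1 / 4" using D_sq by (simp add: divide_le_eq)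
  then have branch: "(edge_weight D 3)\<^sup>2 \<le> D\<^sup>2 / 9 + 9 / 4"
    using D_ge by (simp add: edge_weight_squared)
  have outer: "(edge_weight 3 1)\<^sup>2 = 100 / 9" by (simp add: edge_weight_squared)
  show ?thesis
    using ext_spectral_radius_le_hub_weight[unfolded outer_weight_sum_def]
      n_ge weight branch D_sq unfolding D_def by (simp add: outer of_nat_diff)
qed

lemma ext_spectral_radius_T4_le:
  assumes n_ge: "9 \<le> n"
  shows "4 * (\<eta>\<^sub>1 (T4 n))\<^sup>2 \<le> hub_weight (n - 5) 2 2 + 1"
proof -
  have "4 < n" using n_ge by simp
  interpret two_level_tree "T4 n" 0 "{1..n - 5}" "{n - 4, n - 3}" 2
    using \<open>4 < n\<close> by (rule two_level_tree_T4)
  define D where "D = real n - 3"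
  have D_ge: "6 \<le> D" using n_ge by (simp add: D_def)
  have D_sq: "36 \<le> D\<^sup>2" using power_mono[OF D_ge, of 2] by simp
  have "4 * D\<^sup>2 + D\<^sup>2 / 2 \<le> (D - 3 / 2) * D\<^sup>2"
    using mult_right_mono[OF D_ge, of "D\<^sup>2"] by (simp add: algebra_simps)
  moreover have "0 \<le> (D + 6) / D\<^sup>2" using D_ge by simp
  ultimately have weight: "4 * D\<^sup>2 + D\<^sup>2 / 2 + 12 \<le> hub_weight (n - 5) 2 2"
    using D_ge unfolding hub_weight_two_two_eq[OF \<open>4 < n\<close> D_def] by linarith
  have "4 / D\<^sup>2 \<le> 1 / 9" using D_sq by (simp add: divide_le_eq)
  then have branch: "(edge_weight D 2)\<^sup>2 \<le> D\<^sup>2 / 4 + 19 / 9"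
    using D_ge by (simp add: edge_weight_squared)
  have outer: "(edge_weight 2 1)\<^sup>2 = 25 / 4" by (simp add: edge_weight_squared)
  have cards: "card {n - 4, n - 3} = 2" using n_ge by auto
  show ?thesis
    using ext_spectral_radius_le_hub_weight[unfolded outer_weight_sum_def cards]
      n_ge weight branch D_sq unfolding D_def by (simp add: outer of_nat_diff)
qed

lemma ext_spectral_radius_T3_less_T2:
  assumes n_ge: "9 \<le> n"
  shows "\<eta>\<^sub>1 (T3 n) < \<eta>\<^sub>1 (T2 n)"
proof -
  have "4 < n" using n_ge by simp
  interpret T2: hub "T2 n" 0 "{1..n - 4}" "{n - 3}" 2 using \<open>4 < n\<close> by (rule hub_T2)
  define D where "D = real n - 3"
  have D_ge: "6 \<le> D" using n_ge by (simp add: D_def)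
  have D_sq: "36 \<le> D\<^sup>2" using power_mono[OF D_ge, of 2] by simp
  have "hub_weight (n - 4) 1 2 - hub_weight (n - 4) 1 3 = 5 / 36 * D\<^sup>2 - 5 / D\<^sup>2"
    unfolding hub_weight_one_two_eq[OF \<open>4 < n\<close> D_def] hub_weight_one_three_eq[OF \<open>4 < n\<close> D_def]
    by (simp add: add_divide_distrib algebra_simps)
  moreover have "5 / D\<^sup>2 \<le> 5 / 36" using D_sq by (simp add: divide_le_eq)
  ultimately have "hub_weight (n - 4) 1 3 + 1 < hub_weight (n - 4) 1 2" using D_sq by linarith
  moreover have "hub_weight (n - 4) 1 2 \<le> 4 * (\<eta>\<^sub>1 (T2 n))\<^sup>2" using T2.hub_weight_le by simp
  ultimately show ?thesis
    using n_ge
    by (intro T2.ext_spectral_radius_less_of_squares[OF _ ext_spectral_radius_T3_le]) auto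
qed

lemma ext_spectral_radius_T4_less_T3:
  assumes n_ge: "9 \<le> n"
  shows "\<eta>\<^sub>1 (T4 n) < \<eta>\<^sub>1 (T3 n)"
proof -
  have "4 < n" using n_ge by simp
  interpret T3: two_level_tree "T3 n" 0 "{1..n - 4}" "{n - 3}" 3
    using \<open>4 < n\<close> by (rule two_level_tree_T3)
  define D where "D = real n - 3"
  have D_ge: "6 \<le> D" using n_ge by (simp add: D_def)
  have D_sq: "36 \<le> D\<^sup>2" using power_mono[OF D_ge, of 2] by simp
  have "hub_weight (n - 4) 1 3 - hub_weight (n - 5) 2 2 = 11 / 18 * D\<^sup>2 + 2 / D\<^sup>2"
    unfolding hub_weight_one_three_eq[OF \<open>4 < n\<close> D_def] hub_weight_two_two_eq[OF \<open>4 < n\<close> D_def]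
    by (simp add: add_divide_distrib algebra_simps)
  moreover have "0 \<le> 2 / D\<^sup>2" by simp
  ultimately have "hub_weight (n - 5) 2 2 + 1 < hub_weight (n - 4) 1 3" using D_sq by linarith
  moreover have "hub_weight (n - 4) 1 3 \<le> 4 * (\<eta>\<^sub>1 (T3 n))\<^sup>2" using T3.hub_weight_le by simp
  ultimately show ?thesis
    using n_ge
    by (intro T3.ext_spectral_radius_less_of_squares[OF _ ext_spectral_radius_T4_le]) auto
qed

lemma (in rooted_tree) ext_spectral_radius_less_T4:
  assumes size: "12 \<le> n" "card (pverts G) = n"
    and max_degree: "\<And>v. v \<in> pverts G \<Longrightarrow> card (nbrs G v) \<le> n - 4"
  shows "\<eta>\<^sub>1 G < \<eta>\<^sub>1 (T4 n)"
proof -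
  have "4 < n" using size(1) by simp
  interpret T4: two_level_tree "T4 n" 0 "{1..n - 5}" "{n - 4, n - 3}" 2
    using \<open>4 < n\<close> by (rule two_level_tree_T4)
  define D where "D = real n - 3"
  have D_ge: "9 \<le> D" using size(1) by (simp add: D_def)
  have cards: "card {n - 4, n - 3} = 2" using size(1) by auto
  show ?thesis
  proof (rule T4.ext_spectral_radius_less_of_squares)
    show "4 * (\<eta>\<^sub>1 G)\<^sup>2 \<le> (D - 1) ^ 3 + 64 + 3 * (D + 3) - 4"
      using ext_spectral_radius_le_max_degree[of "n - 4"] size max_degree
      by (simp add: D_def of_nat_diff)
    show "hub_weight (n - 5) 2 2 \<le> 4 * (\<eta>\<^sub>1 (T4 n))\<^sup>2"
      using T4.hub_weight_le unfolding cards by simp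
    have "0 \<le> (D + 6) / D\<^sup>2" using D_ge by simp
    then have "(D - 3 / 2) * D\<^sup>2 + 2 * D \<le> hub_weight (n - 5) 2 2"
      unfolding hub_weight_two_two_eq[OF \<open>4 < n\<close> D_def] by linarith
    moreover have "(D - 1) ^ 3 + 64 + 3 * (D + 3) - 4 < (D - 3 / 2) * D\<^sup>2 + 2 * D"
      using mult_nonneg_nonneg[of "D - 9" "3 * D + 19"] D_ge
      by (simp add: algebra_simps power2_eq_square power3_eq_cube)
    ultimately show "(D - 1) ^ 3 + 64 + 3 * (D + 3) - 4 < hub_weight (n - 5) 2 2" by linarith
  qed (use size in simp)
qed

lemma simple_tree_card_nbrs_le:
  assumes size: "4 < n" "card (pverts T) = n" and tree: "simple_tree T" and vertex: "v \<in> pverts T"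
    and "\<not> digraph_iso (with_proj T) (with_proj (star n))"
    and "\<not> digraph_iso (with_proj T) (with_proj (T1 n))"
    and "\<not> digraph_iso (with_proj T) (with_proj (T2 n))"
    and "\<not> digraph_iso (with_proj T) (with_proj (T3 n))"
    and "\<not> digraph_iso (with_proj T) (with_proj (T4 n))"
  shows "card (nbrs T v) \<le> n - 4"
proof -
  obtain p where "rooted_tree T v p" using simple_tree_imp_rooted_tree[OF tree vertex] .
  then have "\<not> n - 3 \<le> card (nbrs T v)"
    using rooted_tree.digraph_iso_of_large_degree[OF _ size] assms(5-) by blast
  then show ?thesis by linarith
qed

theorem theorem1p3:
  fixes n :: nat and T :: "'a pair_pre_digraph"
  assumes "12 \<le> n"
    and "simple_tree T" and "card (pverts T) = n"
    and "\<not> digraph_iso (with_proj T) (with_proj (star n))"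
    and "\<not> digraph_iso (with_proj T) (with_proj (T1 n))"
    and "\<not> digraph_iso (with_proj T) (with_proj (T2 n))"
    and "\<not> digraph_iso (with_proj T) (with_proj (T3 n))"
    and "\<not> digraph_iso (with_proj T) (with_proj (T4 n))"
  shows "\<eta>\<^sub>1 T < \<eta>\<^sub>1 (T4 n) \<and> \<eta>\<^sub>1 (T4 n) < \<eta>\<^sub>1 (T3 n) \<and> \<eta>\<^sub>1 (T3 n) < \<eta>\<^sub>1 (T2 n)
    \<and> \<eta>\<^sub>1 (T2 n) < \<eta>\<^sub>1 (T1 n) \<and> \<eta>\<^sub>1 (T1 n) < \<eta>\<^sub>1 (star n)"
proof -
  have "pverts T \<noteq> {}" using assms(1,3) by auto
  then obtain c p where "rooted_tree T c p"
    using simple_tree_imp_rooted_tree[OF assms(2)] by blast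
  moreover have "card (nbrs T v) \<le> n - 4" if "v \<in> pverts T" for v
    using assms(1) by (intro simple_tree_card_nbrs_le[OF _ assms(3,2) that assms(4-8)]) simp
  ultimately have "\<eta>\<^sub>1 T < \<eta>\<^sub>1 (T4 n)"
    using assms(1,3) by (intro rooted_tree.ext_spectral_radius_less_T4)
  then show ?thesis
    using assms(1) ext_spectral_radius_T4_less_T3[of n] ext_spectral_radius_T3_less_T2[of n]
      ext_spectral_radius_T2_less_T1[of n] ext_spectral_radius_T1_less_star[of n] by simp
qed

end
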